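(* Let $\alpha$ be the shift on the reduced group $C^*$-algebra $C^*_r(\mathbb F_\infty)$ of the free group on countably infinitely many generators, and let $T_\alpha$ be the homeomorphism $\sigma\mapsto\sigma\circ\alpha$ of the state space $S(C^*_r(\mathbb F_\infty))$ with the weak$^*$ topology. Then $h_{\mathrm{top}}(T_\alpha)=0$.
   Context: The generators of $\mathbb F_\infty$ are indexed by $\mathbb Z$, and $\{u_i\}_{i\in\mathbb Z}$ are the corresponding canonical unitaries in $C^*_r(\mathbb F_\infty)$; the shift $\alpha$ is the automorphism determined by $\alpha(u_i)=u_{i+1}$ for all $i\in\mathbb Z$. For a unital $C^*$-algebra $A$, $S(A)$ is the set of positive linear functionals $\phi$ on $A$ with $\phi(1)=1$. Topological entropy: for a homeomorphism $T$ of a compact metrizable space $X$ and a finite open cover $\mathcal U$ of $X$, let $N(\mathcal U)$ be the smallest cardinality of a subcover, $h_{\mathrm{top}}(T,\mathcal U)=\lim_{n\to\infty}\frac1n\log N(\mathcal U\vee T^{-1}\mathcal U\vee\cdots\vee T^{-(n-1)}\mathcal U)$, and $h_{\mathrm{top}}(T)=\sup_{\mathcal U}h_{\mathrm{top}}(T,\mathcal U)$ over all finite open covers. *)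

theory Defs
  imports "HOL-Analysis.Analysis"
begin

section \<open>Free groups\<close>

text \<open>A letter \<open>(i, True)\<close> stands for the generator indexed by \<open>i\<close> and
  \<open>(i, False)\<close> for its inverse. Elements of the free group are the reduced words.
  Since the library's type class for not necessarily commutative groups is
  \<^class>\<open>group_add\<close>, groups are written additively throughout.\<close>

definition flip :: "'a \<times> bool \<Rightarrow> 'a \<times> bool" where
  "flip x = (fst x, \<not> snd x)"

definition reduced_word :: "('a \<times> bool) list \<Rightarrow> bool" where
  "reduced_word w \<longleftrightarrow> successively (\<lambda>x y. y \<noteq> flip x) w"

typedef 'a free_group = "{w :: ('a \<times> bool) list. reduced_word w}"
  morphisms word_of of_word
  by (rule exI[of _ "[]"]) (simp add: reduced_word_def)

setup_lifting type_definition_free_group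

text \<open>Left multiplication of a reduced word by a letter, with cancellation.\<close>

definition lmul :: "'a \<times> bool \<Rightarrow> ('a \<times> bool) list \<Rightarrow> ('a \<times> bool) list" where
  "lmul x w = (case w of [] \<Rightarrow> [x] | y # v \<Rightarrow> if y = flip x then v else x # w)"

lemma flip_flip [simp]: "flip (flip x) = x"
  by (simp add: flip_def)

lemma flip_eq_iff [simp]: "flip x = flip y \<longleftrightarrow> x = y"
  by (metis flip_flip)

lemma reduced_Nil [simp]: "reduced_word []"
  by (simp add: reduced_word_def)

lemma reduced_Cons: "reduced_word (x # w) \<longleftrightarrow> (w = [] \<or> hd w \<noteq> flip x) \<and> reduced_word w"
  by (auto simp: reduced_word_def successively_Cons)

lemma reduced_lmul: "reduced_word w \<Longrightarrow> reduced_word (lmul x w)"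
  by (auto simp: lmul_def reduced_Cons split: list.splits)

lemma lmul_flip: "reduced_word w \<Longrightarrow> lmul x (lmul (flip x) w) = w"
  by (cases w; cases "tl w") (auto simp: lmul_def reduced_Cons)

lemma lmul_flip': "reduced_word w \<Longrightarrow> lmul (flip x) (lmul x w) = w"
  using lmul_flip[of w "flip x"] by simp

lemma lmul_reduced: "reduced_word (x # w) \<Longrightarrow> lmul x w = x # w"
  by (cases w) (auto simp: lmul_def reduced_Cons)

lemma reduced_foldr_lmul: "reduced_word v \<Longrightarrow> reduced_word (foldr lmul u v)"
  by (induction u) (auto intro: reduced_lmul)

lemma foldr_lmul_lmul:
  "reduced_word w \<Longrightarrow> foldr lmul (lmul x u) w = lmul x (foldr lmul u w)"
proof (cases u)
  case (Cons y v)
  assume "reduced_word w"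
  then show ?thesis
    using lmul_flip[OF reduced_foldr_lmul, of w x v] Cons by (auto simp: lmul_def)
qed (simp add: lmul_def)

lemma foldr_lmul_assoc:
  "reduced_word w \<Longrightarrow> foldr lmul (foldr lmul u v) w = foldr lmul u (foldr lmul v w)"
  by (induction u) (auto simp: foldr_lmul_lmul)

lemma foldr_lmul_Nil: "reduced_word w \<Longrightarrow> foldr lmul w [] = w"
  by (induction w) (auto simp: reduced_Cons intro!: lmul_reduced)

lemma foldr_lmul_inverse:
  "reduced_word v \<Longrightarrow> foldr lmul (rev (map flip w)) (foldr lmul w v) = v"
  by (induction w) (auto simp: lmul_flip' reduced_foldr_lmul)

lemma reduced_inverse: "reduced_word w \<Longrightarrow> reduced_word (rev (map flip w))"
proof (induction w)
  case (Cons x w)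
  then have "last (rev (map flip w)) \<noteq> x" if "w \<noteq> []"
    using that by (cases w) (auto simp: reduced_Cons)
  with Cons show ?case
    by (auto simp: reduced_word_def successively_append_iff successively_Cons)
qed simp

instantiation free_group :: (type) group_add
begin

lift_definition zero_free_group :: "'a free_group" is "[]"
  by simp

lift_definition plus_free_group :: "'a free_group \<Rightarrow> 'a free_group \<Rightarrow> 'a free_group"
  is "\<lambda>u v. foldr lmul u v"
  by (rule reduced_foldr_lmul)

lift_definition uminus_free_group :: "'a free_group \<Rightarrow> 'a free_group"
  is "\<lambda>w. rev (map flip w)"
  by (rule reduced_inverse)

definition minus_free_group :: "'a free_group \<Rightarrow> 'a free_group \<Rightarrow> 'a free_group" where
  "minus_free_group u v = u + (- v)"

instance
proof
  fix a b c :: "'a free_group"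
  show "a + b + c = a + (b + c)"
    by transfer (simp add: foldr_lmul_assoc)
  show "0 + a = a" by transfer simp
  show "a + 0 = a" by transfer (simp add: foldr_lmul_Nil)
  show "- a + a = 0"
    by transfer (metis foldr_lmul_Nil foldr_lmul_inverse reduced_Nil)
  show "a + (- b) = a - b" by (simp add: minus_free_group_def)
qed

end

lift_definition generator :: "'a \<Rightarrow> 'a free_group" is "\<lambda>i. [(i, True)]"
  by (simp add: reduced_Cons)


section \<open>The Hilbert space of square-summable functions\<close>

typedef 'g ell2 = "{f :: 'g \<Rightarrow> complex. (\<lambda>x. (cmod (f x))\<^sup>2) summable_on UNIV}"
  morphisms ell2_nth Ell2
  by (rule exI[of _ "\<lambda>_. 0"]) simp

setup_lifting type_definition_ell2

lemma ell2_mult_abs_summable: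
  fixes f g :: "'g \<Rightarrow> complex"
  assumes "(\<lambda>x. (cmod (f x))\<^sup>2) summable_on UNIV" "(\<lambda>x. (cmod (g x))\<^sup>2) summable_on UNIV"
  shows "(\<lambda>x. cmod (cnj (f x) * g x)) summable_on UNIV"
proof (rule summable_on_comparison_test)
  show "(\<lambda>x. (cmod (f x))\<^sup>2 + (cmod (g x))\<^sup>2) summable_on UNIV"
    by (rule summable_on_add[OF assms])
  fix x
  have "0 \<le> (cmod (f x) - cmod (g x))\<^sup>2" by simp
  then have "2 * (cmod (f x) * cmod (g x)) \<le> (cmod (f x))\<^sup>2 + (cmod (g x))\<^sup>2"
    by (simp add: power2_diff)
  moreover have "0 \<le> cmod (f x) * cmod (g x)" by simp
  ultimately show "cmod (cnj (f x) * g x) \<le> (cmod (f x))\<^sup>2 + (cmod (g x))\<^sup>2"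
    unfolding norm_mult complex_mod_cnj by linarith
qed simp_all

lemma ell2_mult_summable:
  fixes f g :: "'g \<Rightarrow> complex"
  assumes "(\<lambda>x. (cmod (f x))\<^sup>2) summable_on UNIV" "(\<lambda>x. (cmod (g x))\<^sup>2) summable_on UNIV"
  shows "(\<lambda>x. cnj (f x) * g x) summable_on UNIV"
  using abs_summable_summable[OF ell2_mult_abs_summable[OF assms]] .

lemma ell2_add_summable:
  fixes f g :: "'g \<Rightarrow> complex"
  assumes "(\<lambda>x. (cmod (f x))\<^sup>2) summable_on UNIV" "(\<lambda>x. (cmod (g x))\<^sup>2) summable_on UNIV"
  shows "(\<lambda>x. (cmod (f x + g x))\<^sup>2) summable_on UNIV"
proof (rule summable_on_comparison_test)
  show "(\<lambda>x. 2 * (cmod (f x))\<^sup>2 + 2 * (cmod (g x))\<^sup>2) summable_on UNIV"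
    by (intro summable_on_add summable_on_cmult_right assms)
  fix x
  have "(cmod (f x + g x))\<^sup>2 \<le> (cmod (f x) + cmod (g x))\<^sup>2"
    by (intro power_mono norm_triangle_ineq) simp
  also have "\<dots> \<le> 2 * (cmod (f x))\<^sup>2 + 2 * (cmod (g x))\<^sup>2"
    using zero_le_power2[of "cmod (f x) - cmod (g x)"]
    by (simp add: power2_diff power2_sum)
  finally show "(cmod (f x + g x))\<^sup>2 \<le> 2 * (cmod (f x))\<^sup>2 + 2 * (cmod (g x))\<^sup>2" .
qed simp_all

lift_definition scaleC_ell2 :: "complex \<Rightarrow> 'g ell2 \<Rightarrow> 'g ell2"
  is "\<lambda>c f x. c * f x"
  by (auto simp: norm_mult power_mult_distrib intro: summable_on_cmult_right)

text \<open>Conjugate-linear in the first variable.\<close>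

definition cinner :: "'g ell2 \<Rightarrow> 'g ell2 \<Rightarrow> complex" where
  "cinner f g = (\<Sum>\<^sub>\<infinity>x. cnj (ell2_nth f x) * ell2_nth g x)"

lemma ell2_nth_summable: "(\<lambda>x. (cmod (ell2_nth f x))\<^sup>2) summable_on UNIV"
  using ell2_nth[of f] by simp

lemma cinner_summable: "(\<lambda>x. cnj (ell2_nth f x) * ell2_nth g x) summable_on UNIV"
  by (intro ell2_mult_summable ell2_nth_summable)

instantiation ell2 :: (type) real_vector
begin

lift_definition zero_ell2 :: "'a ell2" is "\<lambda>_. 0" by simp
lift_definition plus_ell2 :: "'a ell2 \<Rightarrow> 'a ell2 \<Rightarrow> 'a ell2" is "\<lambda>f g x. f x + g x"
  by (rule ell2_add_summable)
lift_definition uminus_ell2 :: "'a ell2 \<Rightarrow> 'a ell2" is "\<lambda>f x. - f x" by simp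
lift_definition minus_ell2 :: "'a ell2 \<Rightarrow> 'a ell2 \<Rightarrow> 'a ell2" is "\<lambda>f g x. f x - g x"
  subgoal for f g using ell2_add_summable[of f "\<lambda>x. - g x"] by simp
  done
definition scaleR_ell2 :: "real \<Rightarrow> 'a ell2 \<Rightarrow> 'a ell2" where
  "scaleR_ell2 r f = scaleC_ell2 (complex_of_real r) f"

instance
proof
  fix a b :: real and x y z :: "'a ell2"
  show "x + y + z = x + (y + z)" by transfer (simp add: add.assoc)
  show "x + y = y + x" by transfer (simp add: add.commute)
  show "0 + x = x" by transfer simp
  show "- x + x = 0" by transfer simp
  show "x - y = x + - y" by transfer simp
  show "a *\<^sub>R (x + y) = a *\<^sub>R x + a *\<^sub>R y"
    unfolding scaleR_ell2_def by transfer (simp add: distrib_left)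
  show "(a + b) *\<^sub>R x = a *\<^sub>R x + b *\<^sub>R x"
    unfolding scaleR_ell2_def by transfer (simp add: distrib_right)
  show "a *\<^sub>R b *\<^sub>R x = (a * b) *\<^sub>R x"
    unfolding scaleR_ell2_def by transfer (simp add: mult.assoc)
  show "1 *\<^sub>R x = x"
    unfolding scaleR_ell2_def by transfer simp
qed

end

lemma cinner_commute: "cinner f g = cnj (cinner g f)"
  by (simp add: cinner_def infsum_cnj[symmetric] mult.commute del: infsum_cnj)

lemma cinner_add_right: "cinner f (g + h) = cinner f g + cinner f h"
proof -
  have "cinner f (g + h) =
      (\<Sum>\<^sub>\<infinity>x. cnj (ell2_nth f x) * ell2_nth g x + cnj (ell2_nth f x) * ell2_nth h x)"
    unfolding cinner_def by (simp add: plus_ell2.rep_eq distrib_left)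
  also have "\<dots> = cinner f g + cinner f h"
    unfolding cinner_def by (intro infsum_add cinner_summable)
  finally show ?thesis .
qed

lemma cinner_scaleC_right: "cinner f (scaleC_ell2 c g) = c * cinner f g"
  unfolding cinner_def
  by (simp add: scaleC_ell2.rep_eq infsum_cmult_right'[symmetric] mult.left_commute)

lemma cinner_add_left: "cinner (f + g) h = cinner f h + cinner g h"
  by (metis cinner_add_right cinner_commute complex_cnj_add)

lemma cinner_scaleC_left: "cinner (scaleC_ell2 c f) g = cnj c * cinner f g"
  by (metis cinner_commute cinner_scaleC_right complex_cnj_mult)

lemma cinner_self: "cinner f f = complex_of_real (\<Sum>\<^sub>\<infinity>x. (cmod (ell2_nth f x))\<^sup>2)"
proof -
  have "((\<lambda>x. complex_of_real ((cmod (ell2_nth f x))\<^sup>2)) has_sum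
      complex_of_real (\<Sum>\<^sub>\<infinity>x. (cmod (ell2_nth f x))\<^sup>2)) UNIV"
    by (intro has_sum_of_real has_sum_infsum ell2_nth_summable)
  moreover have "complex_of_real ((cmod z)\<^sup>2) = cnj z * z" for z
    using complex_norm_square[of z] by (simp add: mult.commute)
  ultimately show ?thesis
    unfolding cinner_def by (simp add: infsumI)
qed

instantiation ell2 :: (type) real_inner
begin

definition inner_ell2 :: "'a ell2 \<Rightarrow> 'a ell2 \<Rightarrow> real" where
  "inner_ell2 f g = Re (cinner f g)"
definition norm_ell2 :: "'a ell2 \<Rightarrow> real" where
  "norm_ell2 f = sqrt (\<Sum>\<^sub>\<infinity>x. (cmod (ell2_nth f x))\<^sup>2)"
definition dist_ell2 :: "'a ell2 \<Rightarrow> 'a ell2 \<Rightarrow> real" where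
  "dist_ell2 f g = norm (f - g)"
definition sgn_ell2 :: "'a ell2 \<Rightarrow> 'a ell2" where
  "sgn_ell2 f = f /\<^sub>R norm f"
definition uniformity_ell2 :: "('a ell2 \<times> 'a ell2) filter" where
  "uniformity_ell2 = (INF e\<in>{0 <..}. principal {(x, y). dist x y < e})"
definition open_ell2 :: "'a ell2 set \<Rightarrow> bool" where
  "open_ell2 U \<longleftrightarrow> (\<forall>x\<in>U. \<forall>\<^sub>F (x', y) in uniformity. x' = x \<longrightarrow> y \<in> U)"

instance
proof
  fix x y z :: "'a ell2" and r :: real and U :: "'a ell2 set"
  show "dist x y = norm (x - y)" by (rule dist_ell2_def)
  show "sgn x = x /\<^sub>R norm x" by (rule sgn_ell2_def)
  show "uniformity = (INF e\<in>{0 <..}. principal {(x :: 'a ell2, y). dist x y < e})"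
    by (rule uniformity_ell2_def)
  show "open U \<longleftrightarrow> (\<forall>x\<in>U. \<forall>\<^sub>F (x', y) in uniformity. x' = x \<longrightarrow> y \<in> U)"
    by (rule open_ell2_def)
  show "x \<bullet> y = y \<bullet> x"
    unfolding inner_ell2_def by (metis cinner_commute cnj.sel(1))
  show "(x + y) \<bullet> z = x \<bullet> z + y \<bullet> z"
    by (simp add: inner_ell2_def cinner_add_left)
  show "(r *\<^sub>R x) \<bullet> y = r * (x \<bullet> y)"
    by (simp add: inner_ell2_def scaleR_ell2_def cinner_scaleC_left)
  show "0 \<le> x \<bullet> x"
    by (simp add: inner_ell2_def cinner_self infsum_nonneg)
  show "norm x = sqrt (x \<bullet> x)"
    by (simp add: inner_ell2_def cinner_self norm_ell2_def)
  show "x \<bullet> x = 0 \<longleftrightarrow> x = 0"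
  proof
    assume "x \<bullet> x = 0"
    then have *: "(\<Sum>\<^sub>\<infinity>i. (cmod (ell2_nth x i))\<^sup>2) = 0"
      by (simp add: inner_ell2_def cinner_self)
    have "(cmod (ell2_nth x i))\<^sup>2 = 0" for i
      by (rule nonneg_infsum_le_0D[of "\<lambda>i. (cmod (ell2_nth x i))\<^sup>2" UNIV])
        (use * ell2_nth_summable[of x] in auto)
    then show "x = 0"
      by (simp add: ell2_nth_inject[symmetric] zero_ell2.rep_eq fun_eq_iff)
  next
    assume "x = 0"
    then show "x \<bullet> x = 0"
      by (simp add: inner_ell2_def cinner_def zero_ell2.rep_eq)
  qed
qed

end

lemma norm_ell2_sq: "(norm f)\<^sup>2 = (\<Sum>\<^sub>\<infinity>x. (cmod (ell2_nth f x))\<^sup>2)"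
  by (simp add: norm_ell2_def infsum_nonneg)

lemma cinner_self_norm: "cinner f f = complex_of_real ((norm f)\<^sup>2)"
  by (simp add: cinner_self norm_ell2_sq)

lemma ell2_sum_le_norm:
  assumes "finite F" shows "(\<Sum>x\<in>F. (cmod (ell2_nth f x))\<^sup>2) \<le> (norm f)\<^sup>2"
  unfolding norm_ell2_sq by (intro finite_sum_le_infsum ell2_nth_summable assms) auto

lemma cmod_ell2_nth_le: "cmod (ell2_nth f x) \<le> norm f"
  using ell2_sum_le_norm[of "{x}" f] by (simp add: power2_le_iff_abs_le)

lemma norm_scaleC_ell2: "norm (scaleC_ell2 c f) = cmod c * norm f"
  by (simp add: norm_ell2_def scaleC_ell2.rep_eq norm_mult power_mult_distrib
      infsum_cmult_right' real_sqrt_mult)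

instance ell2 :: (type) banach
proof
  fix X :: "nat \<Rightarrow> 'a ell2"
  assume X: "Cauchy X"
  have nth_diff: "ell2_nth (f - g) x = ell2_nth f x - ell2_nth g x" for f g :: "'a ell2" and x
    by (simp add: minus_ell2.rep_eq)
  have "Cauchy (\<lambda>n. ell2_nth (X n) x)" for x
  proof (rule metric_CauchyI)
    fix e :: real assume "0 < e"
    then obtain M where M: "\<forall>m\<ge>M. \<forall>n\<ge>M. dist (X m) (X n) < e"
      using X by (auto simp: Cauchy_def)
    show "\<exists>M. \<forall>m\<ge>M. \<forall>n\<ge>M. dist (ell2_nth (X m) x) (ell2_nth (X n) x) < e"
    proof (intro exI allI impI)
      fix m n assume "m \<ge> M" "n \<ge> M"
      then show "dist (ell2_nth (X m) x) (ell2_nth (X n) x) < e"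
        using M cmod_ell2_nth_le[of "X m - X n" x]
        by (metis dist_norm nth_diff order_le_less_trans)
    qed
  qed
  then have "\<exists>l. (\<lambda>n. ell2_nth (X n) x) \<longlonglongrightarrow> l" for x
    using Cauchy_convergent convergent_def by blast
  then obtain f where f: "(\<lambda>n. ell2_nth (X n) x) \<longlonglongrightarrow> f x" for x
    by metis
  have bound: "(\<Sum>x\<in>F. (cmod (f x - ell2_nth (X m) x))\<^sup>2) \<le> e\<^sup>2"
    if "finite F" "e > 0" "\<And>n. n \<ge> m \<Longrightarrow> norm (X n - X m) \<le> e" for F m e
  proof (rule LIMSEQ_le_const2)
    show "(\<lambda>n. \<Sum>x\<in>F. (cmod (ell2_nth (X n) x - ell2_nth (X m) x))\<^sup>2)
        \<longlonglongrightarrow> (\<Sum>x\<in>F. (cmod (f x - ell2_nth (X m) x))\<^sup>2)"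
      by (intro tendsto_intros f)
    have "(\<Sum>x\<in>F. (cmod (ell2_nth (X n) x - ell2_nth (X m) x))\<^sup>2) \<le> e\<^sup>2" if "n \<ge> m" for n
    proof -
      have "(norm (X n - X m))\<^sup>2 \<le> e\<^sup>2"
        by (intro power_mono \<open>\<And>n. n \<ge> m \<Longrightarrow> norm (X n - X m) \<le> e\<close> that norm_ge_zero)
      then show ?thesis
        using ell2_sum_le_norm[OF \<open>finite F\<close>, of "X n - X m"] by (simp add: nth_diff)
    qed
    then show "\<exists>N. \<forall>n\<ge>N. (\<Sum>x\<in>F. (cmod (ell2_nth (X n) x - ell2_nth (X m) x))\<^sup>2) \<le> e\<^sup>2"
      by blast
  qed
  have summ: "(\<lambda>x. (cmod (f x - ell2_nth (X m) x))\<^sup>2) summable_on UNIV"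
    if "e > 0" "\<And>n. n \<ge> m \<Longrightarrow> norm (X n - X m) \<le> e" for m e
  proof (rule nonneg_bounded_partial_sums_imp_summable_on[of _ _ "e\<^sup>2"])
    show "\<forall>\<^sub>F F in finite_subsets_at_top UNIV. (\<Sum>x\<in>F. (cmod (f x - ell2_nth (X m) x))\<^sup>2) \<le> e\<^sup>2"
      by (rule eventually_finite_subsets_at_top_weakI) (rule bound[OF _ that])
  qed simp
  have ev: "\<exists>M. \<forall>m\<ge>M. \<forall>n\<ge>M. norm (X n - X m) \<le> e" if e: "e > 0" for e
  proof -
    obtain M where "\<forall>m\<ge>M. \<forall>n\<ge>M. dist (X m) (X n) < e"
      using X e unfolding Cauchy_def by blast
    then have "\<forall>m\<ge>M. \<forall>n\<ge>M. norm (X n - X m) \<le> e"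
      by (simp add: dist_norm less_imp_le)
    then show ?thesis by blast
  qed
  obtain M where M: "\<forall>m\<ge>M. \<forall>n\<ge>M. norm (X n - X m) \<le> 1"
    using ev[of 1] by auto
  have "(\<lambda>x. (cmod ((f x - ell2_nth (X M) x) + ell2_nth (X M) x))\<^sup>2) summable_on UNIV"
    by (intro ell2_add_summable ell2_nth_summable summ[of 1]) (use M in auto)
  then have fs: "(\<lambda>x. (cmod (f x))\<^sup>2) summable_on UNIV" by simp
  define L where "L = Ell2 f"
  have L: "ell2_nth L = f"
    unfolding L_def using fs by (simp add: Ell2_inverse)
  have "X \<longlonglongrightarrow> L"
  proof (rule LIMSEQ_I)
    fix r :: real assume "0 < r"
    then obtain M where M: "\<forall>m\<ge>M. \<forall>n\<ge>M. norm (X n - X m) \<le> r / 2"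
      using ev[of "r / 2"] by auto
    have "norm (X m - L) < r" if "m \<ge> M" for m
    proof -
      have "(norm (L - X m))\<^sup>2 \<le> (r / 2)\<^sup>2"
        unfolding norm_ell2_sq nth_diff L
      proof (rule infsum_le_finite_sums)
        have *: "0 < r / 2" "\<And>n. n \<ge> m \<Longrightarrow> norm (X n - X m) \<le> r / 2"
          using M that \<open>0 < r\<close> by auto
        show "(\<lambda>x. (cmod (f x - ell2_nth (X m) x))\<^sup>2) summable_on UNIV"
          by (rule summ[OF *])
        show "(\<Sum>x\<in>F. (cmod (f x - ell2_nth (X m) x))\<^sup>2) \<le> (r / 2)\<^sup>2" if "finite F" for F
          by (rule bound[OF that *])
      qed
      then have "norm (L - X m) \<le> r / 2"
        by (rule power2_le_imp_le) (use \<open>0 < r\<close> in simp)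
      then show ?thesis
        using \<open>0 < r\<close> norm_minus_commute[of L "X m"] by linarith
    qed
    then show "\<exists>M. \<forall>m\<ge>M. norm (X m - L) < r" by blast
  qed
  then show "convergent X" by (auto simp: convergent_def)
qed


section \<open>The reduced group C*-algebra\<close>

text \<open>Bounded operators are elements of the library's space of bounded real-linear maps on
  the Hilbert space. The complex-linear ones form a closed subspace with the same operator norm,
  so taking norm closures of sets of complex-linear operators in this type is harmless.\<close>

type_synonym 'g op = "'g ell2 \<Rightarrow>\<^sub>L 'g ell2"

lemma scaleC_ell2_add: "scaleC_ell2 c (f + g) = scaleC_ell2 c f + scaleC_ell2 c g"
  by transfer (simp add: distrib_left)

lemma scaleC_ell2_scaleR: "scaleC_ell2 c (r *\<^sub>R f) = r *\<^sub>R scaleC_ell2 c f"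
  unfolding scaleR_ell2_def by transfer (simp add: mult.left_commute)

lemma bounded_linear_scaleC_ell2: "bounded_linear (scaleC_ell2 c)"
  by (rule bounded_linear_intro[of _ "cmod c"])
     (auto simp: scaleC_ell2_add scaleC_ell2_scaleR norm_scaleC_ell2 mult.commute)

definition scaleC_op :: "complex \<Rightarrow> 'g op \<Rightarrow> 'g op" where
  "scaleC_op c a = Blinfun (scaleC_ell2 c) o\<^sub>L a"

lemma scaleC_op_apply [simp]: "scaleC_op c a x = scaleC_ell2 c (a x)"
  by (simp add: scaleC_op_def bounded_linear_Blinfun_apply bounded_linear_scaleC_ell2)

definition is_cadjoint :: "'g op \<Rightarrow> 'g op \<Rightarrow> bool" where
  "is_cadjoint a b \<longleftrightarrow> (\<forall>x y. cinner (b x) y = cinner x (a y))"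

text \<open>The adjoint is unique (\<open>is_cadjoint_unique\<close> below), and it exists for every element of the
  reduced group C*-algebra (\<open>ex_cadjoint_reduced_cstar\<close>).\<close>

definition cadjoint :: "'g op \<Rightarrow> 'g op" where
  "cadjoint a = (THE b. is_cadjoint a b)"

text \<open>The unitary \<open>f \<mapsto> f \<circ> p\<inverse>\<close> of a permutation \<open>p\<close>;
  junk value if \<open>p\<close> is not bijective.\<close>

lift_definition permute_ell2 :: "('g \<Rightarrow> 'g) \<Rightarrow> 'g ell2 \<Rightarrow> 'g ell2"
  is "\<lambda>p f. if bij p then f \<circ> inv p else f"
  subgoal for p f
    using summable_on_reindex_bij_betw[of "inv p" UNIV UNIV "\<lambda>x. (cmod (f x))\<^sup>2"]
    by (auto simp: bij_imp_bij_inv)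
  done

lemma norm_permute_ell2: "norm (permute_ell2 p f) = norm f"
proof (cases "bij p")
  case True
  then show ?thesis
    using infsum_reindex_bij_betw[of "inv p" UNIV UNIV "\<lambda>x. (cmod (ell2_nth f x))\<^sup>2"]
    by (simp add: norm_ell2_def permute_ell2.rep_eq bij_imp_bij_inv)
qed (simp add: norm_ell2_def permute_ell2.rep_eq)

lemma bounded_linear_permute_ell2:
  fixes p :: "'g \<Rightarrow> 'g"
  shows "bounded_linear (permute_ell2 p)"
proof (rule bounded_linear_intro[of _ 1])
  fix f g :: "'g ell2" and r :: real
  show "permute_ell2 p (f + g) = permute_ell2 p f + permute_ell2 p g"
    by transfer (auto simp: fun_eq_iff)
  show "permute_ell2 p (r *\<^sub>R f) = r *\<^sub>R permute_ell2 p f"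
    unfolding scaleR_ell2_def by transfer (auto simp: fun_eq_iff)
  show "norm (permute_ell2 p f) \<le> norm f * 1"
    by (simp add: norm_permute_ell2)
qed

lemma bij_add_left: "bij (\<lambda>h::'g::group_add. g + h)"
  by (rule bij_betw_byWitness[where f' = "\<lambda>h. - g + h"]) (auto simp: add.assoc[symmetric])

lemma inv_add_left: "inv (\<lambda>h::'g::group_add. g + h) = (\<lambda>h. - g + h)"
  by (rule inv_equality) (auto simp: add.assoc[symmetric])

lift_definition left_translate :: "'g::group_add \<Rightarrow> 'g ell2 \<Rightarrow> 'g ell2"
  is "\<lambda>g f h. f (- g + h)"
  subgoal for g f
    using summable_on_reindex_bij_betw[OF bij_add_left, of "\<lambda>x. (cmod (f x))\<^sup>2" "- g"] by simp
  done

lemma left_translate_conv_permute: "left_translate g = permute_ell2 (\<lambda>h. g + h)"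
  by (rule ext, transfer) (auto simp: bij_add_left inv_add_left)

definition left_regular :: "'g::group_add \<Rightarrow> 'g op" where
  "left_regular g = Blinfun (left_translate g)"

lemma left_regular_apply [simp]: "left_regular g f = left_translate g f"
  by (simp add: left_regular_def bounded_linear_Blinfun_apply left_translate_conv_permute
      bounded_linear_permute_ell2)

text \<open>The image of the complex group algebra under the left regular representation.\<close>

definition group_algebra :: "'g::group_add op set" where
  "group_algebra = {(\<Sum>g\<in>F. scaleC_op (c g) (left_regular g)) | F c. finite F}"

definition reduced_cstar :: "'g::group_add op set" where
  "reduced_cstar = closure group_algebra"

definition star_automorphism :: "'g op set \<Rightarrow> ('g op \<Rightarrow> 'g op) \<Rightarrow> bool" where
  "star_automorphism A \<alpha> \<longleftrightarrow> bij_betw \<alpha> A A \<and>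
     (\<forall>a\<in>A. \<forall>b\<in>A. \<alpha> (a + b) = \<alpha> a + \<alpha> b) \<and>
     (\<forall>c. \<forall>a\<in>A. \<alpha> (scaleC_op c a) = scaleC_op c (\<alpha> a)) \<and>
     (\<forall>a\<in>A. \<forall>b\<in>A. \<alpha> (a o\<^sub>L b) = \<alpha> a o\<^sub>L \<alpha> b) \<and>
     (\<forall>a\<in>A. \<alpha> (cadjoint a) = cadjoint (\<alpha> a))"


section \<open>State spaces\<close>

text \<open>Functionals on an algebra \<open>A\<close> of operators are represented by functions
  that are \<^const>\<open>undefined\<close> outside \<open>A\<close>, so that the weak* topology, the topology
  of pointwise convergence on \<open>A\<close>, is induced by the product topology.\<close>

definition state_space :: "'g op set \<Rightarrow> ('g op \<Rightarrow> complex) set" where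
  "state_space A = {\<phi> \<in> extensional A.
     (\<forall>a\<in>A. \<forall>b\<in>A. \<phi> (a + b) = \<phi> a + \<phi> b) \<and>
     (\<forall>c. \<forall>a\<in>A. \<phi> (scaleC_op c a) = c * \<phi> a) \<and>
     (\<forall>a\<in>A. \<phi> (cadjoint a o\<^sub>L a) \<in> \<real>\<^sub>\<ge>\<^sub>0) \<and>
     \<phi> id_blinfun = 1}"

definition state_topology :: "'g op set \<Rightarrow> ('g op \<Rightarrow> complex) topology" where
  "state_topology A = subtopology (product_topology (\<lambda>_. euclidean) A) (state_space A)"

definition state_map ::
  "'g op set \<Rightarrow> ('g op \<Rightarrow> 'g op) \<Rightarrow> ('g op \<Rightarrow> complex) \<Rightarrow> ('g op \<Rightarrow> complex)" where
  "state_map A \<alpha> \<sigma> = restrict (\<sigma> \<circ> \<alpha>) A"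


section \<open>Topological entropy\<close>

definition finite_open_cover :: "'x topology \<Rightarrow> 'x set set \<Rightarrow> bool" where
  "finite_open_cover X \<U> \<longleftrightarrow> finite \<U> \<and> (\<forall>U\<in>\<U>. openin X U) \<and> \<Union>\<U> = topspace X"

definition subcover_number :: "'x topology \<Rightarrow> 'x set set \<Rightarrow> nat" where
  "subcover_number X \<U> =
     (LEAST n. \<exists>\<V>. \<V> \<subseteq> \<U> \<and> finite \<V> \<and> \<Union>\<V> = topspace X \<and> card \<V> = n)"

definition cover_join :: "'x set set \<Rightarrow> 'x set set \<Rightarrow> 'x set set" where
  "cover_join \<U> \<V> = {U \<inter> V | U V. U \<in> \<U> \<and> V \<in> \<V>}"

definition cover_preimage :: "'x topology \<Rightarrow> ('x \<Rightarrow> 'x) \<Rightarrow> 'x set set \<Rightarrow> 'x set set" where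
  "cover_preimage X T \<U> = (\<lambda>U. {x \<in> topspace X. T x \<in> U}) ` \<U>"

primrec iterated_join :: "'x topology \<Rightarrow> ('x \<Rightarrow> 'x) \<Rightarrow> 'x set set \<Rightarrow> nat \<Rightarrow> 'x set set" where
  "iterated_join X T \<U> 0 = {topspace X}"
| "iterated_join X T \<U> (Suc n) =
     cover_join (iterated_join X T \<U> n) (cover_preimage X (T ^^ n) \<U>)"

definition cover_entropy :: "'x topology \<Rightarrow> ('x \<Rightarrow> 'x) \<Rightarrow> 'x set set \<Rightarrow> real" where
  "cover_entropy X T \<U> =
     lim (\<lambda>n. ln (real (subcover_number X (iterated_join X T \<U> n))) / real n)"

definition topological_entropy :: "'x topology \<Rightarrow> ('x \<Rightarrow> 'x) \<Rightarrow> ereal" where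
  "topological_entropy X T = (SUP \<U> \<in> {\<U>. finite_open_cover X \<U>}. ereal (cover_entropy X T \<U>))"


section \<open>Existence of the shift\<close>

lemma cinner_conv_inner:
  "cinner x y = complex_of_real (x \<bullet> y) + \<i> * complex_of_real (scaleC_ell2 \<i> x \<bullet> y)"
  by (simp add: inner_ell2_def cinner_scaleC_left complex_eq_iff)

lemma tendsto_cinner [tendsto_intros]:
  assumes "(f \<longlongrightarrow> x) F" "(g \<longlongrightarrow> y) F"
  shows "((\<lambda>n. cinner (f n) (g n)) \<longlongrightarrow> cinner x y) F"
  unfolding cinner_conv_inner
  by (intro tendsto_intros assms bounded_linear.tendsto[OF bounded_linear_scaleC_ell2])

lemma cinner_diff_right: "cinner f (g - h) = cinner f g - cinner f h"
  using cinner_add_right[of f "g - h" h] by simp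

lemma cinner_diff_left: "cinner (f - g) h = cinner f h - cinner g h"
  using cinner_add_left[of "f - g" g h] by simp

lemma ell2_eqI_cinner:
  assumes "\<And>z. cinner x z = cinner y z" shows "x = y"
proof -
  have "cinner (x - y) (x - y) = 0" using assms by (simp add: cinner_diff_left)
  then show ?thesis by (simp add: cinner_self_norm)
qed

lemma is_cadjoint_unique: "is_cadjoint a b \<Longrightarrow> is_cadjoint a c \<Longrightarrow> b = c"
  unfolding is_cadjoint_def by (intro blinfun_eqI ell2_eqI_cinner) metis

lemma cadjoint_eqI: "is_cadjoint a b \<Longrightarrow> cadjoint a = b"
  unfolding cadjoint_def by (blast intro: the_equality is_cadjoint_unique)

lemma is_cadjoint_add: "is_cadjoint a b \<Longrightarrow> is_cadjoint a' b' \<Longrightarrow> is_cadjoint (a + a') (b + b')"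
  by (simp add: is_cadjoint_def blinfun.add_left cinner_add_left cinner_add_right)

lemma is_cadjoint_diff: "is_cadjoint a b \<Longrightarrow> is_cadjoint a' b' \<Longrightarrow> is_cadjoint (a - a') (b - b')"
  by (simp add: is_cadjoint_def blinfun.diff_left cinner_diff_left cinner_diff_right)

lemma is_cadjoint_scaleC: "is_cadjoint a b \<Longrightarrow> is_cadjoint (scaleC_op c a) (scaleC_op (cnj c) b)"
  by (simp add: is_cadjoint_def cinner_scaleC_left cinner_scaleC_right)

lemma is_cadjoint_0: "is_cadjoint 0 0"
  by (simp add: is_cadjoint_def cinner_conv_inner scaleC_ell2_scaleR[of _ 0 0, simplified])

lemma is_cadjoint_sum:
  "(\<And>i. i \<in> F \<Longrightarrow> is_cadjoint (a i) (b i)) \<Longrightarrow> is_cadjoint (sum a F) (sum b F)"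
  by (induction F rule: infinite_finite_induct) (auto intro: is_cadjoint_0 is_cadjoint_add)

lemma norm_cadjoint_le:
  assumes "is_cadjoint a b" shows "norm b \<le> norm a"
proof (rule norm_blinfun_bound)
  fix x
  have "norm (b x) * norm (b x) = b x \<bullet> b x"
    by (simp add: power2_norm_eq_inner[symmetric] power2_eq_square)
  also have "\<dots> = x \<bullet> a (b x)"
    using assms by (simp add: is_cadjoint_def inner_ell2_def)
  also have "\<dots> \<le> norm x * norm (a (b x))" by (rule norm_cauchy_schwarz)
  also have "\<dots> \<le> norm x * (norm a * norm (b x))"
    by (intro mult_left_mono norm_blinfun norm_ge_zero)
  finally have "norm (b x) * norm (b x) \<le> (norm a * norm x) * norm (b x)"
    by (simp add: ac_simps)
  then show "norm (b x) \<le> norm a * norm x"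
    by (cases "norm (b x) = 0") (auto simp: mult_le_cancel_right)
qed simp

lemma cinner_permute:
  "cinner (permute_ell2 p x) (permute_ell2 p y) = cinner x y"
proof (cases "bij p")
  case True
  then show ?thesis
    using infsum_reindex_bij_betw[of "inv p" UNIV UNIV "\<lambda>h. cnj (ell2_nth x h) * ell2_nth y h"]
    by (simp add: cinner_def permute_ell2.rep_eq bij_imp_bij_inv)
qed (simp add: cinner_def permute_ell2.rep_eq)

lemma permute_permute_inv: "bij p \<Longrightarrow> permute_ell2 p (permute_ell2 (inv p) x) = x"
  by (transfer, auto simp: fun_eq_iff bij_imp_bij_inv inv_inv_eq bij_is_surj surj_f_inv_f)

lemma permute_inv_permute: "bij p \<Longrightarrow> permute_ell2 (inv p) (permute_ell2 p x) = x"
  by (transfer, auto simp: fun_eq_iff bij_imp_bij_inv inv_inv_eq bij_is_inj inv_f_f)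

lemma cinner_permute_left: "bij p \<Longrightarrow> cinner (permute_ell2 p x) y = cinner x (permute_ell2 (inv p) y)"
  by (metis cinner_permute permute_permute_inv)

lemma is_cadjoint_left_regular: "is_cadjoint (left_regular g) (left_regular (- g))"
proof -
  have *: "inv (\<lambda>h. - g + h) = (\<lambda>h. g + h)"
    using inv_add_left[of "- g"] by simp
  show ?thesis
    using cinner_permute_left[OF bij_add_left, of "- g"]
    by (simp add: is_cadjoint_def left_translate_conv_permute *)
qed

lemma ex_cadjoint_reduced_cstar:
  fixes a :: "'g::group_add op"
  assumes "a \<in> reduced_cstar" shows "\<exists>b. is_cadjoint a b"
proof -
  obtain s where s: "\<And>n. s n \<in> group_algebra" "s \<longlonglongrightarrow> a"
    using assms unfolding reduced_cstar_def closure_sequential by blast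
  have "\<exists>b. is_cadjoint c b" if c: "c \<in> group_algebra" for c :: "'g op"
  proof -
    obtain F and k :: "'g \<Rightarrow> complex" where "c = (\<Sum>g\<in>F. scaleC_op (k g) (left_regular g))"
      using c unfolding group_algebra_def by blast
    then have "is_cadjoint c (\<Sum>g\<in>F. scaleC_op (cnj (k g)) (left_regular (- g)))"
      by (auto intro!: is_cadjoint_sum is_cadjoint_scaleC is_cadjoint_left_regular)
    then show ?thesis by blast
  qed
  then have "\<forall>n. \<exists>b. is_cadjoint (s n) b" using s(1) by blast
  from choice[OF this] obtain t where t: "\<And>n. is_cadjoint (s n) (t n)" by blast
  have "Cauchy s" using s(2) by (auto intro: LIMSEQ_imp_Cauchy)
  have "Cauchy t"
  proof (rule metric_CauchyI)
    fix e :: real assume "0 < e"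
    then obtain M where M: "\<And>m n. m \<ge> M \<Longrightarrow> n \<ge> M \<Longrightarrow> dist (s m) (s n) < e"
      using \<open>Cauchy s\<close> metric_CauchyD by metis
    have "dist (t m) (t n) < e" if "m \<ge> M" "n \<ge> M" for m n
      using M[OF that] norm_cadjoint_le[OF is_cadjoint_diff[OF t t], of m n]
      unfolding dist_norm by linarith
    then show "\<exists>M. \<forall>m\<ge>M. \<forall>n\<ge>M. dist (t m) (t n) < e" by blast
  qed
  then obtain b where b: "t \<longlonglongrightarrow> b"
    using Cauchy_convergent convergent_def by blast
  have "cinner (b x) y = cinner x (a y)" for x y
  proof (rule LIMSEQ_unique)
    show "(\<lambda>n. cinner (t n x) y) \<longlonglongrightarrow> cinner (b x) y"
      by (intro tendsto_intros b)
    have "(\<lambda>n. cinner x (s n y)) \<longlonglongrightarrow> cinner x (a y)"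
      by (intro tendsto_intros s(2))
    then show "(\<lambda>n. cinner (t n x) y) \<longlonglongrightarrow> cinner x (a y)"
      using t by (simp add: is_cadjoint_def)
  qed
  then show ?thesis by (auto simp: is_cadjoint_def)
qed

definition permute_op :: "('g \<Rightarrow> 'g) \<Rightarrow> 'g op" where
  "permute_op p = Blinfun (permute_ell2 p)"

lemma permute_op_apply [simp]: "permute_op p f = permute_ell2 p f"
  by (simp add: permute_op_def bounded_linear_Blinfun_apply bounded_linear_permute_ell2)

definition conj_op :: "('g \<Rightarrow> 'g) \<Rightarrow> 'g op \<Rightarrow> 'g op" where
  "conj_op p a = permute_op p o\<^sub>L a o\<^sub>L permute_op (inv p)"

lemma conj_op_apply [simp]: "conj_op p a x = permute_ell2 p (a (permute_ell2 (inv p) x))"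
  by (simp add: conj_op_def)

lemma permute_add: "permute_ell2 p (x + y) = permute_ell2 p x + permute_ell2 p y"
  by (rule linear_add[OF bounded_linear.linear[OF bounded_linear_permute_ell2]])

lemma permute_scaleC: "permute_ell2 p (scaleC_ell2 c x) = scaleC_ell2 c (permute_ell2 p x)"
  by transfer (auto simp: fun_eq_iff)

lemma conj_op_add: "conj_op p (a + b) = conj_op p a + conj_op p b"
  by (rule blinfun_eqI) (simp add: blinfun.add_left permute_add)

lemma conj_op_scaleC: "conj_op p (scaleC_op c a) = scaleC_op c (conj_op p a)"
  by (rule blinfun_eqI) (simp add: permute_scaleC)

lemma conj_op_compose: "bij p \<Longrightarrow> conj_op p (a o\<^sub>L b) = conj_op p a o\<^sub>L conj_op p b"
  by (rule blinfun_eqI) (simp add: permute_inv_permute)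

lemma conj_op_inv: "bij p \<Longrightarrow> conj_op (inv p) (conj_op p a) = a"
  by (rule blinfun_eqI) (simp add: permute_inv_permute inv_inv_eq)

lemma conj_op_inv': "bij p \<Longrightarrow> conj_op p (conj_op (inv p) a) = a"
  by (rule blinfun_eqI) (simp add: permute_permute_inv inv_inv_eq)

lemma is_cadjoint_conj_op: "bij p \<Longrightarrow> is_cadjoint a b \<Longrightarrow> is_cadjoint (conj_op p a) (conj_op p b)"
  using cinner_permute_left[of "inv p"]
  by (simp add: is_cadjoint_def cinner_permute_left bij_imp_bij_inv inv_inv_eq)

lemma bounded_linear_conj_op: "bounded_linear (conj_op p)"
  unfolding conj_op_def
  by (intro bounded_linear_compose[OF bounded_bilinear.bounded_linear_left[OF bounded_bilinear_blinfun_compose]]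
      bounded_bilinear.bounded_linear_right[OF bounded_bilinear_blinfun_compose])

lemma conj_op_left_regular:
  fixes p :: "'g::group_add \<Rightarrow> 'g"
  assumes "bij p" "\<And>g h. p (g + h) = p g + p h"
  shows "conj_op p (left_regular g) = left_regular (p g)"
proof -
  have p0: "p 0 = 0" using assms(2)[of 0 0] by (metis add.right_neutral add_left_cancel)
  have pm: "p (- g) = - p g" for g
    using assms(2)[of "- g" g] p0 by (simp add: eq_neg_iff_add_eq_0)
  have "p (- g + inv p h) = - p g + h" for h
    using assms by (simp add: pm bij_is_surj surj_f_inv_f)
  then show ?thesis
    by (intro blinfun_eqI, simp add: ell2_nth_inject[symmetric] fun_eq_iff
        permute_ell2.rep_eq left_translate.rep_eq assms(1) bij_imp_bij_inv inv_inv_eq)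
qed

lemma conj_op_group_algebra:
  fixes p :: "'g::group_add \<Rightarrow> 'g"
  assumes "bij p" "\<And>g h. p (g + h) = p g + p h" "a \<in> group_algebra"
  shows "conj_op p a \<in> group_algebra"
proof -
  obtain F c where F: "finite F" "a = (\<Sum>g\<in>F. scaleC_op (c g) (left_regular g))"
    using assms(3) unfolding group_algebra_def by blast
  have "conj_op p a = (\<Sum>g\<in>F. scaleC_op (c g) (left_regular (p g)))"
    unfolding F(2) linear_sum[OF bounded_linear.linear[OF bounded_linear_conj_op]]
    by (simp add: conj_op_scaleC conj_op_left_regular assms)
  also have "\<dots> = (\<Sum>g\<in>p ` F. scaleC_op (c (inv p g)) (left_regular g))"
    using assms(1) by (subst sum.reindex)
      (auto simp: bij_is_inj inv_f_f intro: inj_on_subset[OF bij_is_inj])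
  finally show ?thesis
    using F(1) unfolding group_algebra_def
    by (intro CollectI exI[of _ "p ` F"] exI[of _ "\<lambda>g. c (inv p g)"]) simp
qed

lemma conj_op_reduced_cstar:
  fixes p :: "'g::group_add \<Rightarrow> 'g"
  assumes "bij p" "\<And>g h. p (g + h) = p g + p h" "a \<in> reduced_cstar"
  shows "conj_op p a \<in> reduced_cstar"
proof -
  obtain s where s: "\<And>n. s n \<in> group_algebra" "s \<longlonglongrightarrow> a"
    using assms(3) unfolding reduced_cstar_def closure_sequential by blast
  have "(\<lambda>n. conj_op p (s n)) \<longlonglongrightarrow> conj_op p a"
    by (rule bounded_linear.tendsto[OF bounded_linear_conj_op s(2)])
  moreover have "\<forall>n. conj_op p (s n) \<in> group_algebra"
    using assms(1,2) s(1) by (blast intro: conj_op_group_algebra)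
  ultimately show ?thesis
    unfolding reduced_cstar_def closure_sequential by (intro exI[of _ "\<lambda>n. conj_op p (s n)"]) simp
qed

lemma star_automorphism_conj_op:
  fixes p :: "'g::group_add \<Rightarrow> 'g"
  assumes p: "bij p" and add: "\<And>g h. p (g + h) = p g + p h"
  shows "star_automorphism reduced_cstar (conj_op p)"
proof -
  have inv_add: "inv p (g + h) = inv p g + inv p h" for g h
    using p add by (metis bij_inv_eq_iff)
  have "bij_betw (conj_op p) reduced_cstar reduced_cstar"
    by (rule bij_betw_byWitness[where f' = "conj_op (inv p)"])
       (use p add in \<open>auto simp: conj_op_inv conj_op_inv' bij_imp_bij_inv inv_add
          intro!: conj_op_reduced_cstar\<close>)
  moreover have "conj_op p (cadjoint a) = cadjoint (conj_op p a)" if "a \<in> reduced_cstar" for a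
    using ex_cadjoint_reduced_cstar[OF that] is_cadjoint_conj_op[OF p] cadjoint_eqI by metis
  ultimately show ?thesis
    by (simp add: star_automorphism_def conj_op_add conj_op_scaleC conj_op_compose p)
qed

lift_definition shift_word :: "int \<Rightarrow> int free_group \<Rightarrow> int free_group"
  is "\<lambda>k. map (\<lambda>(i, b). (i + k, b))"
proof -
  fix k :: int and w :: "(int \<times> bool) list"
  have "(case y of (i, b) \<Rightarrow> (i + k, b)) = flip (case x of (i, b) \<Rightarrow> (i + k, b)) \<longleftrightarrow> y = flip x"
    for x y :: "int \<times> bool"
    by (auto simp: flip_def split: prod.splits)
  then show "reduced_word w \<Longrightarrow> reduced_word (map (\<lambda>(i, b). (i + k, b)) w)"
    by (simp add: reduced_word_def successively_map)
qed

lemma shift_word_add: "shift_word k (u + v) = shift_word k u + shift_word k v"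
proof transfer
  fix k :: int and u v :: "(int \<times> bool) list"
  let ?s = "\<lambda>(i, b). (i + k, b :: bool)"
  have "map ?s (lmul x w) = lmul (?s x) (map ?s w)" for x w
    by (cases w) (auto simp: lmul_def flip_def split: prod.splits)
  then show "map ?s (foldr lmul u v) = foldr lmul (map ?s u) (map ?s v)"
    by (induction u) auto
qed

lemma shift_word_shift_word: "shift_word k (shift_word l u) = shift_word (k + l) u"
  by transfer (auto simp: ac_simps)

lemma shift_word_0: "shift_word 0 u = u"
  by transfer (auto intro: map_idI)

lemma bij_shift_word: "bij (shift_word k)"
  by (rule bij_betw_byWitness[where f' = "shift_word (- k)"])
     (auto simp: shift_word_shift_word shift_word_0)

lemma shift_word_generator: "shift_word k (generator i) = generator (i + k)"
  by transfer simp

lemma free_shift_exists: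
  "\<exists>\<alpha>. star_automorphism reduced_cstar \<alpha> \<and>
       (\<forall>i::int. \<alpha> (left_regular (generator i)) = left_regular (generator (i + 1)))"
proof (intro exI conjI allI)
  show "star_automorphism reduced_cstar (conj_op (shift_word 1))"
    by (rule star_automorphism_conj_op) (rule bij_shift_word, rule shift_word_add)
  fix i :: int
  have "conj_op (shift_word 1) (left_regular (generator i)) = left_regular (shift_word 1 (generator i))"
    by (rule conj_op_left_regular) (rule bij_shift_word, rule shift_word_add)
  then show "conj_op (shift_word 1) (left_regular (generator i)) = left_regular (generator (i + 1))"
    by (simp only: shift_word_generator)
qed

end

theory Submission
  imports Defs "HOL-Real_Asymp.Real_Asymp"
begin

text \<open>For a word \<open>g \<noteq> 0\<close>, sufficiently spread out shifts of \<open>g\<close> are free generators, and for these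
  Leinert's inequality bounds the norm of a linear combination in the reduced algebra by twice the
  \<open>\<ell>\<^sup>2\<close> norm of its coefficients. Dually, a state can be larger than a given \<open>\<epsilon>\<close> at only boundedly
  many of the shifts of \<open>g\<close>, with a bound independent of the state. Up to precision \<open>\<epsilon>\<close>, the orbit
  segment of length \<open>n\<close> of a state is thus described by boundedly many positions in \<open>{..<n}\<close>
  together with rounded values there, so that there are only polynomially many such descriptions.
  Since the state space is compact and states are uniformly bounded, every open cover has a Lebesgue
  number with respect to finitely many group elements, and such a description determines members of
  the cover along the orbit segment.\<close>

section \<open>The reduced group algebra\<close>

lemma left_regular_add: "left_regular (g + h) = left_regular g o\<^sub>L left_regular h"
proof (rule blinfun_eqI)
  fix f :: "'a ell2"
  have "left_translate (g + h) f = left_translate g (left_translate h f)"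
    by transfer (simp add: minus_add fun_eq_iff diff_conv_add_uminus add.assoc del: add_uminus_conv_diff)
  then show "left_regular (g + h) f = (left_regular g o\<^sub>L left_regular h) f" by simp
qed

lemma left_regular_0: "left_regular 0 = id_blinfun"
proof (rule blinfun_eqI)
  fix f :: "'a ell2"
  have "left_translate 0 f = f" by transfer simp
  then show "left_regular 0 f = id_blinfun f" by simp
qed

lemma norm_left_regular_le: "norm (left_regular g) \<le> 1"
  by (rule norm_blinfun_bound) (simp_all add: left_translate_conv_permute norm_permute_ell2)

lemma scaleC_op_add: "scaleC_op c (a + b) = scaleC_op c a + scaleC_op c b"
  by (rule blinfun_eqI) (simp add: blinfun.add_left scaleC_ell2_add)

lemma scaleC_ell2_scaleC: "scaleC_ell2 c (scaleC_ell2 d f) = scaleC_ell2 (c * d) f"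
  by transfer (simp add: mult.assoc)

lemma scaleC_op_scaleC: "scaleC_op c (scaleC_op d a) = scaleC_op (c * d) a"
  by (rule blinfun_eqI) (simp add: scaleC_ell2_scaleC)

lemma scaleC_op_scaleR: "scaleC_op (complex_of_real r) a = r *\<^sub>R a"
  by (rule blinfun_eqI) (simp add: blinfun.scaleR_left scaleR_ell2_def)

lemma scaleC_op_0: "scaleC_op c 0 = 0"
  using scaleC_op_add[of c 0 0] by simp

lemma scaleC_op_0_left: "scaleC_op 0 a = 0"
  using scaleC_op_scaleR[of 0 a] by simp

lemma scaleC_op_sum: "scaleC_op c (sum a F) = (\<Sum>i\<in>F. scaleC_op c (a i))"
  by (induction F rule: infinite_finite_induct) (auto simp: scaleC_op_0 scaleC_op_add)

lemma norm_scaleC_op_le: "norm (scaleC_op c a) \<le> cmod c * norm a"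
proof (rule norm_blinfun_bound)
  fix x
  show "norm (scaleC_op c a x) \<le> cmod c * norm a * norm x"
    using norm_blinfun[of a x] by (simp add: norm_scaleC_ell2 mult.assoc mult_left_mono)
qed simp

lemma bounded_linear_scaleC_op: "bounded_linear (scaleC_op c)"
  unfolding scaleC_op_def
  by (rule bounded_bilinear.bounded_linear_right[OF bounded_bilinear_blinfun_compose])

lemma compose_scaleC_op_left: "scaleC_op c a o\<^sub>L b = scaleC_op c (a o\<^sub>L b)"
  by (rule blinfun_eqI) simp

lemma left_regular_compose_scaleC:
  "left_regular g o\<^sub>L scaleC_op c b = scaleC_op c (left_regular g o\<^sub>L b)"
  by (rule blinfun_eqI) (simp add: left_translate_conv_permute permute_scaleC)

lemma is_cadjoint_sym: "is_cadjoint a b \<Longrightarrow> is_cadjoint b a"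
  unfolding is_cadjoint_def by (metis cinner_commute)

lemma is_cadjoint_compose:
  "is_cadjoint a b \<Longrightarrow> is_cadjoint a' b' \<Longrightarrow> is_cadjoint (a o\<^sub>L a') (b' o\<^sub>L b)"
  by (simp add: is_cadjoint_def)

lemma is_cadjoint_scaleR: "is_cadjoint a b \<Longrightarrow> is_cadjoint (r *\<^sub>R a) (r *\<^sub>R b)"
  using is_cadjoint_scaleC[of a b "complex_of_real r"] by (simp add: scaleC_op_scaleR)

lemma is_cadjoint_limit:
  assumes "\<And>n. is_cadjoint (s n) (t n)" "s \<longlonglongrightarrow> a" "t \<longlonglongrightarrow> b"
  shows "is_cadjoint a b"
  unfolding is_cadjoint_def
proof (intro allI)
  fix x y
  show "cinner (b x) y = cinner x (a y)"
  proof (rule LIMSEQ_unique)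
    show "(\<lambda>n. cinner (t n x) y) \<longlonglongrightarrow> cinner (b x) y"
      by (intro tendsto_intros assms)
    have "(\<lambda>n. cinner x (s n y)) \<longlonglongrightarrow> cinner x (a y)"
      by (intro tendsto_intros assms)
    then show "(\<lambda>n. cinner (t n x) y) \<longlonglongrightarrow> cinner x (a y)"
      using assms(1) by (simp add: is_cadjoint_def)
  qed
qed

section \<open>The group algebra as an algebra with involution\<close>

lemma group_algebra_sum:
  "finite F \<Longrightarrow> (\<Sum>g\<in>F. scaleC_op (c g) (left_regular g)) \<in> group_algebra"
  unfolding group_algebra_def by blast

lemma group_algebra_add:
  fixes a b :: "'g::group_add op"
  assumes "a \<in> group_algebra" "b \<in> group_algebra"
  shows "a + b \<in> group_algebra"
proof -
  obtain F c where F: "finite F" "a = (\<Sum>g\<in>F. scaleC_op (c g) (left_regular g))"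
    using assms(1) unfolding group_algebra_def by blast
  obtain G d where G: "finite G" "b = (\<Sum>g\<in>G. scaleC_op (d g) (left_regular g))"
    using assms(2) unfolding group_algebra_def by blast
  have scaleC_op_add_left: "scaleC_op (x + y) u = scaleC_op x u + scaleC_op y u"
    for x y and u :: "'g op"
  proof (rule blinfun_eqI)
    fix f
    have "scaleC_ell2 (x + y) v = scaleC_ell2 x v + scaleC_ell2 y v" for v :: "'g ell2"
      by transfer (simp add: distrib_right)
    then show "scaleC_op (x + y) u f = (scaleC_op x u + scaleC_op y u) f"
      by (simp add: blinfun.add_left)
  qed
  \<comment> \<open>Both combinations are padded with zero coefficients to the common index set
    \<open>F \<union> G\<close>.\<close>
  have "a = (\<Sum>g\<in>F \<union> G. scaleC_op (if g \<in> F then c g else 0) (left_regular g))"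
    unfolding F(2) using F(1) G(1)
    by (intro sum.mono_neutral_cong_left) (auto simp: scaleC_op_0_left)
  moreover have "b = (\<Sum>g\<in>F \<union> G. scaleC_op (if g \<in> G then d g else 0) (left_regular g))"
    unfolding G(2) using F(1) G(1)
    by (intro sum.mono_neutral_cong_left) (auto simp: scaleC_op_0_left)
  ultimately have "a + b = (\<Sum>g\<in>F \<union> G. scaleC_op
      ((if g \<in> F then c g else 0) + (if g \<in> G then d g else 0)) (left_regular g))"
    by (simp only: scaleC_op_add_left sum.distrib)
  then show ?thesis
    using F(1) G(1) group_algebra_sum[of "F \<union> G"] by simp
qed

lemma group_algebra_scaleC: "a \<in> group_algebra \<Longrightarrow> scaleC_op k a \<in> group_algebra"
proof -
  assume "a \<in> group_algebra"
  then obtain F c where F: "finite F" "a = (\<Sum>g\<in>F. scaleC_op (c g) (left_regular g))"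
    unfolding group_algebra_def by blast
  show ?thesis
    unfolding F(2) scaleC_op_sum scaleC_op_scaleC by (rule group_algebra_sum[OF F(1)])
qed

lemma left_regular_in_group_algebra: "left_regular g \<in> group_algebra"
  using group_algebra_sum[of "{g}" "\<lambda>_. 1"] scaleC_op_scaleR[of 1 "left_regular g"] by simp

lemma zero_in_group_algebra: "0 \<in> group_algebra"
  using group_algebra_sum[of "{}"] by simp

lemma group_algebra_sum_in:
  "(\<And>i. i \<in> F \<Longrightarrow> a i \<in> group_algebra) \<Longrightarrow> sum a F \<in> group_algebra"
  by (induction F rule: infinite_finite_induct) (auto intro: group_algebra_add zero_in_group_algebra)

lemma group_algebra_compose:
  assumes "a \<in> group_algebra" "b \<in> group_algebra"
  shows "a o\<^sub>L b \<in> group_algebra"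
proof -
  interpret L: bounded_bilinear "(o\<^sub>L) :: 'a op \<Rightarrow> 'a op \<Rightarrow> 'a op"
    by (rule bounded_bilinear_blinfun_compose)
  obtain F c where F: "a = (\<Sum>g\<in>F. scaleC_op (c g) (left_regular g))"
    using assms(1) unfolding group_algebra_def by blast
  obtain G d where G: "b = (\<Sum>g\<in>G. scaleC_op (d g) (left_regular g))"
    using assms(2) unfolding group_algebra_def by blast
  show ?thesis
    unfolding F G L.sum_left L.sum_right compose_scaleC_op_left left_regular_compose_scaleC
      left_regular_add[symmetric]
    by (intro group_algebra_sum_in group_algebra_scaleC left_regular_in_group_algebra)
qed

lemma group_algebra_cadjoint:
  fixes a :: "'g::group_add op"
  assumes "a \<in> group_algebra" shows "\<exists>b\<in>group_algebra. is_cadjoint a b"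
proof -
  obtain F and k :: "'g \<Rightarrow> complex" where F: "a = (\<Sum>g\<in>F. scaleC_op (k g) (left_regular g))"
    using assms unfolding group_algebra_def by blast
  have "is_cadjoint a (\<Sum>g\<in>F. scaleC_op (cnj (k g)) (left_regular (- g)))"
    unfolding F by (intro is_cadjoint_sum is_cadjoint_scaleC is_cadjoint_left_regular)
  then show ?thesis
    by (blast intro: group_algebra_sum_in group_algebra_scaleC left_regular_in_group_algebra)
qed

section \<open>Passage to the norm closure\<close>

lemma group_algebra_subset_reduced_cstar: "group_algebra \<subseteq> reduced_cstar"
  unfolding reduced_cstar_def by (rule closure_subset)

lemma left_regular_in_reduced_cstar: "left_regular g \<in> reduced_cstar"
  using left_regular_in_group_algebra group_algebra_subset_reduced_cstar by blast

lemma id_in_reduced_cstar: "id_blinfun \<in> reduced_cstar"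
  using left_regular_in_reduced_cstar[of 0] by (simp add: left_regular_0)

lemma reduced_cstar_limit:
  assumes "a \<in> reduced_cstar"
  obtains s where "\<And>n. s n \<in> group_algebra" "s \<longlonglongrightarrow> a"
  using assms unfolding reduced_cstar_def closure_sequential by blast

lemma reduced_cstar_limitI:
  "(\<And>n. s n \<in> group_algebra) \<Longrightarrow> s \<longlonglongrightarrow> a \<Longrightarrow> a \<in> reduced_cstar"
  unfolding reduced_cstar_def closure_sequential by blast

lemma reduced_cstar_add:
  assumes "a \<in> reduced_cstar" "b \<in> reduced_cstar" shows "a + b \<in> reduced_cstar"
proof -
  obtain s where s: "\<And>n. s n \<in> group_algebra" "s \<longlonglongrightarrow> a" by (rule reduced_cstar_limit[OF assms(1)]) blast
  obtain t where t: "\<And>n. t n \<in> group_algebra" "t \<longlonglongrightarrow> b" by (rule reduced_cstar_limit[OF assms(2)]) blast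
  show ?thesis
    by (rule reduced_cstar_limitI[of "\<lambda>n. s n + t n"]) (auto intro: group_algebra_add s t tendsto_add)
qed

lemma reduced_cstar_compose:
  assumes "a \<in> reduced_cstar" "b \<in> reduced_cstar" shows "a o\<^sub>L b \<in> reduced_cstar"
proof -
  obtain s where s: "\<And>n. s n \<in> group_algebra" "s \<longlonglongrightarrow> a" by (rule reduced_cstar_limit[OF assms(1)]) blast
  obtain t where t: "\<And>n. t n \<in> group_algebra" "t \<longlonglongrightarrow> b" by (rule reduced_cstar_limit[OF assms(2)]) blast
  show ?thesis
    by (rule reduced_cstar_limitI[of "\<lambda>n. s n o\<^sub>L t n"])
      (auto intro: group_algebra_compose s t
        bounded_bilinear.tendsto[OF bounded_bilinear_blinfun_compose])
qed

lemma reduced_cstar_scaleC: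
  assumes "a \<in> reduced_cstar" shows "scaleC_op c a \<in> reduced_cstar"
proof -
  obtain s where s: "\<And>n. s n \<in> group_algebra" "s \<longlonglongrightarrow> a" by (rule reduced_cstar_limit[OF assms(1)]) blast
  show ?thesis
    by (rule reduced_cstar_limitI[of "\<lambda>n. scaleC_op c (s n)"])
      (auto intro: group_algebra_scaleC s bounded_linear.tendsto[OF bounded_linear_scaleC_op])
qed

lemma reduced_cstar_scaleR: "a \<in> reduced_cstar \<Longrightarrow> r *\<^sub>R a \<in> reduced_cstar"
  using reduced_cstar_scaleC[of a "complex_of_real r"] by (simp add: scaleC_op_scaleR)

lemma reduced_cstar_diff: "a \<in> reduced_cstar \<Longrightarrow> b \<in> reduced_cstar \<Longrightarrow> a - b \<in> reduced_cstar"
  using reduced_cstar_add[of a "(-1) *\<^sub>R b"] reduced_cstar_scaleR[of b "-1"] by simp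

text \<open>Adjoints of an approximating sequence lie in the group algebra and converge, because
  taking adjoints does not increase norms. This adds to \<open>ex_cadjoint_reduced_cstar\<close>
  that the adjoint stays in the algebra.\<close>

lemma reduced_cstar_cadjoint:
  assumes "a \<in> reduced_cstar" obtains b where "b \<in> reduced_cstar" "is_cadjoint a b"
proof -
  obtain s where s: "\<And>n. s n \<in> group_algebra" "s \<longlonglongrightarrow> a" by (rule reduced_cstar_limit[OF assms(1)]) blast
  have "\<forall>n. \<exists>t. t \<in> group_algebra \<and> is_cadjoint (s n) t" using group_algebra_cadjoint s(1) by blast
  from choice[OF this] obtain t where t: "\<And>n. t n \<in> group_algebra" "\<And>n. is_cadjoint (s n) (t n)"
    by blast
  obtain b where b: "is_cadjoint a b" using ex_cadjoint_reduced_cstar[OF assms] by blast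
  have "t \<longlonglongrightarrow> b"
  proof (rule LIM_zero_cancel, rule Lim_null_comparison)
    show "\<forall>\<^sub>F n in sequentially. norm (t n - b) \<le> norm (s n - a)"
      by (intro always_eventually allI norm_cadjoint_le is_cadjoint_diff t b)
    show "(\<lambda>n. norm (s n - a)) \<longlonglongrightarrow> 0" using s(2) by (intro tendsto_norm_zero LIM_zero)
  qed
  then show ?thesis using reduced_cstar_limitI t(1) b that by blast
qed

lemma closed_reduced_cstar: "closed reduced_cstar"
  by (simp add: reduced_cstar_def)

text \<open>The equation \<open>(1 - y)\<^sup>2 = 1 - x\<close> says that \<open>y\<close> is a fixed point of
  \<open>y \<mapsto> (x + y\<^sup>2) / 2\<close>, a contraction of the self-adjoint part of a ball of radius less than 1.\<close>

lemma reduced_cstar_sqrt: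
  fixes x :: "'g::group_add op"
  assumes x: "x \<in> reduced_cstar" "is_cadjoint x x" "norm x < 1"
  obtains y where "y \<in> reduced_cstar" "is_cadjoint y y" "y o\<^sub>L y = id_blinfun - x"
proof -
  interpret L: bounded_bilinear "(o\<^sub>L) :: 'g op \<Rightarrow> 'g op \<Rightarrow> 'g op"
    by (rule bounded_bilinear_blinfun_compose)
  define r where "r = norm x"
  define S where "S = {y :: 'g op. y \<in> reduced_cstar \<and> is_cadjoint y y \<and> norm y \<le> r}"
  define f where "f y = (1/2) *\<^sub>R (x + (y o\<^sub>L y))" for y :: "'g op"
  have r: "0 \<le> r" "r < 1" using x(3) by (auto simp: r_def)
  have "closed {y :: 'g op. is_cadjoint y y}"
    unfolding closed_sequential_limits using is_cadjoint_limit by blast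
  moreover have "S = reduced_cstar \<inter> {y. is_cadjoint y y} \<inter> cball 0 r"
    by (auto simp: S_def)
  ultimately have "complete S"
    by (auto simp: complete_eq_closed intro!: closed_Int closed_reduced_cstar)
  moreover have "S \<noteq> {}" using x by (auto simp: S_def r_def)
  moreover have "f ` S \<subseteq> S"
  proof clarify
    fix y assume y: "y \<in> S"
    have "norm (y o\<^sub>L y) \<le> r * r"
      using norm_blinfun_compose[of y y] y mult_mono[of "norm y" r "norm y" r] r
      by (auto simp: S_def)
    \<comment> \<open>As \<open>r < 1\<close>, the square of \<open>y\<close> stays in the ball of
      radius \<open>r\<close>, and so does its average with \<open>x\<close>.\<close>
    also have "\<dots> \<le> r" using r mult_left_mono[of r 1 r] by simp
    finally have "norm (x + (y o\<^sub>L y)) \<le> 2 * r"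
      using norm_triangle_ineq[of x "y o\<^sub>L y"] by (simp add: r_def)
    then show "f y \<in> S"
      using y x by (auto simp: S_def f_def intro!: reduced_cstar_scaleR reduced_cstar_add
          reduced_cstar_compose is_cadjoint_scaleR is_cadjoint_add is_cadjoint_compose)
  qed
  moreover have "dist (f y) (f z) \<le> r * dist y z" if "y \<in> S" "z \<in> S" for y z
  proof -
    \<comment> \<open>The telescoping \<open>y^2 - z^2 = y (y - z) + (y - z) z\<close> holds without
      commutativity and gives the contraction constant \<open>r\<close>.\<close>
    have "f y - f z = (1/2) *\<^sub>R ((y o\<^sub>L (y - z)) + ((y - z) o\<^sub>L z))"
      by (simp add: f_def L.diff_left L.diff_right scaleR_diff_right[symmetric])
    then have "norm (f y - f z) \<le> (norm y * norm (y - z) + norm (y - z) * norm z) / 2"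
      using norm_triangle_ineq[of "y o\<^sub>L (y - z)" "(y - z) o\<^sub>L z"]
        norm_blinfun_compose[of y "y - z"] norm_blinfun_compose[of "y - z" z] by simp
    also have "\<dots> \<le> (r * norm (y - z) + norm (y - z) * r) / 2"
      using that by (intro divide_right_mono add_mono mult_mono) (auto simp: S_def r)
    finally show ?thesis by (simp add: dist_norm mult.commute)
  qed
  ultimately obtain y where y: "y \<in> S" "f y = y"
    using Banach_fix[of S r f] r by blast
  \<comment> \<open>The root asked for is \<open>id_blinfun - y\<close>, not the fixed point
    \<open>y\<close> itself.\<close>
  have "2 *\<^sub>R y = 2 *\<^sub>R f y" using y(2) by simp
  then have "x + (y o\<^sub>L y) = y + y" by (simp add: f_def scaleR_2)
  moreover have "(id_blinfun - y) o\<^sub>L (id_blinfun - y) = id_blinfun + (y o\<^sub>L y) - (y + y)"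
    by (rule blinfun_eqI) (simp add: blinfun.diff_left blinfun.diff_right blinfun.add_left algebra_simps)
  ultimately have "(id_blinfun - y) o\<^sub>L (id_blinfun - y) = id_blinfun - x"
    by (metis add_diff_cancel_right)
  moreover have "is_cadjoint (id_blinfun - y) (id_blinfun - y)"
    using y by (intro is_cadjoint_diff) (auto simp: S_def is_cadjoint_def)
  moreover have "id_blinfun - y \<in> reduced_cstar"
    using y by (intro reduced_cstar_diff id_in_reduced_cstar) (auto simp: S_def)
  ultimately show ?thesis using that by blast
qed

section \<open>States\<close>

lemma state_add:
  "\<sigma> \<in> state_space A \<Longrightarrow> a \<in> A \<Longrightarrow> b \<in> A \<Longrightarrow> \<sigma> (a + b) = \<sigma> a + \<sigma> b"
  by (simp add: state_space_def)

lemma state_scaleC: "\<sigma> \<in> state_space A \<Longrightarrow> a \<in> A \<Longrightarrow> \<sigma> (scaleC_op c a) = c * \<sigma> a"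
  by (simp add: state_space_def)

lemma state_scaleR:
  "\<sigma> \<in> state_space A \<Longrightarrow> a \<in> A \<Longrightarrow> \<sigma> (r *\<^sub>R a) = complex_of_real r * \<sigma> a"
  using state_scaleC[of \<sigma> A a "complex_of_real r"] by (simp add: scaleC_op_scaleR)

lemma state_diff:
  "\<sigma> \<in> state_space reduced_cstar \<Longrightarrow> a \<in> reduced_cstar \<Longrightarrow> b \<in> reduced_cstar \<Longrightarrow>
    \<sigma> (a - b) = \<sigma> a - \<sigma> b"
  using state_add[of \<sigma> reduced_cstar a "(-1) *\<^sub>R b"] state_scaleR[of \<sigma> reduced_cstar b "-1"]
    reduced_cstar_scaleR[of b "-1"] by simp

lemma state_id: "\<sigma> \<in> state_space A \<Longrightarrow> \<sigma> id_blinfun = 1"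
  by (simp add: state_space_def)

text \<open>Positivity in \<open>state_space\<close> refers to the definite description
  \<open>cadjoint\<close>; uniqueness of adjoints lets any witness \<open>b\<close> replace
  it.\<close>

lemma state_nonneg:
  "\<sigma> \<in> state_space A \<Longrightarrow> a \<in> A \<Longrightarrow> is_cadjoint a b \<Longrightarrow> \<sigma> (b o\<^sub>L a) \<in> \<real>\<^sub>\<ge>\<^sub>0"
  using cadjoint_eqI[of a b] by (auto simp: state_space_def)

lemma state_sum_group_algebra:
  assumes "\<sigma> \<in> state_space reduced_cstar"
  shows "\<sigma> (\<Sum>g\<in>F. scaleC_op (c g) (left_regular (h g))) = (\<Sum>g\<in>F. c g * \<sigma> (left_regular (h g)))"
proof (induction F rule: infinite_finite_induct)
  case (insert x F)
  have "(\<Sum>g\<in>F. scaleC_op (c g) (left_regular (h g))) \<in> reduced_cstar"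
    using group_algebra_subset_reduced_cstar
      group_algebra_sum_in[of F "\<lambda>g. scaleC_op (c g) (left_regular (h g))"]
    by (blast intro: group_algebra_scaleC left_regular_in_group_algebra)
  then show ?case
    using insert assms
    by (simp add: state_add state_scaleC reduced_cstar_scaleC left_regular_in_reduced_cstar)
\<comment> \<open>The value \<open>\<sigma> 0 = 0\<close> settles empty and infinite index sets,
  whose sums are 0.\<close>
qed (use state_scaleR[OF assms id_in_reduced_cstar, of 0] in simp_all)

text \<open>A self-adjoint square root writes \<open>1 - x\<close> as adjoint times operator, so
  \<open>1 - \<sigma> x\<close> is a nonnegative real.\<close>

lemma state_self_adjoint_less_1:
  assumes \<sigma>: "\<sigma> \<in> state_space reduced_cstar"
    and x: "x \<in> reduced_cstar" "is_cadjoint x x" "norm x < 1"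
  shows "\<sigma> x \<in> \<real>" "Re (\<sigma> x) \<le> 1"
proof -
  obtain y where "y \<in> reduced_cstar" "is_cadjoint y y" "y o\<^sub>L y = id_blinfun - x"
    using reduced_cstar_sqrt[OF x] by blast
  then have "\<sigma> (id_blinfun - x) \<in> \<real>\<^sub>\<ge>\<^sub>0" using state_nonneg[OF \<sigma>] by metis
  then have "1 - \<sigma> x \<in> \<real>\<^sub>\<ge>\<^sub>0"
    by (simp add: state_diff[OF \<sigma> id_in_reduced_cstar x(1)] state_id[OF \<sigma>])
  then show "\<sigma> x \<in> \<real>" "Re (\<sigma> x) \<le> 1"
    by (auto simp: complex_nonneg_Reals_iff complex_is_Real_iff)
qed

text \<open>Rescaling reduces this to \<open>state_self_adjoint_less_1\<close>; both signs are used
  to bound the absolute value of the real number \<open>\<sigma> x\<close>.\<close>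

lemma state_self_adjoint_bound:
  assumes \<sigma>: "\<sigma> \<in> state_space reduced_cstar"
    and x: "x \<in> reduced_cstar" "is_cadjoint x x"
  shows "cmod (\<sigma> x) \<le> norm x"
proof (rule field_le_epsilon)
  fix e :: real assume e: "e > 0"
  \<comment> \<open>The extra \<open>e\<close> makes the rescaled norm strictly less than 1 and
    avoids a division by zero.\<close>
  define r where "r = norm x + e"
  have r: "r > 0" using e norm_ge_zero[of x] unfolding r_def by linarith
  have small: "norm ((s / r) *\<^sub>R x) < 1" if "\<bar>s\<bar> = 1" for s
    using r e that by (simp add: r_def abs_of_pos)
  have *: "\<sigma> ((s / r) *\<^sub>R x) = complex_of_real (s / r) * \<sigma> x" for s
    by (rule state_scaleR[OF \<sigma> x(1)])
  have "\<sigma> ((s / r) *\<^sub>R x) \<in> \<real> \<and> Re (\<sigma> ((s / r) *\<^sub>R x)) \<le> 1" if "\<bar>s\<bar> = 1" for s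
    using state_self_adjoint_less_1[OF \<sigma> reduced_cstar_scaleR[OF x(1)] is_cadjoint_scaleR[OF x(2)]
        small[OF that]] by blast
  from this[of 1] this[of "-1"] have "Im (\<sigma> x) = 0" "Re (\<sigma> x) \<le> r" "- Re (\<sigma> x) \<le> r"
    using r unfolding * by (auto simp: complex_is_Real_iff field_simps)
  then show "cmod (\<sigma> x) \<le> norm x + e"
    by (simp add: cmod_eq_Re r_def)
qed

text \<open>The constant 2 comes from bounding the real and imaginary parts separately;
  the optimal constant is 1.\<close>

lemma state_bound:
  assumes \<sigma>: "\<sigma> \<in> state_space reduced_cstar" and a: "a \<in> reduced_cstar"
  shows "cmod (\<sigma> a) \<le> 2 * norm a"
proof -
  obtain b where b: "b \<in> reduced_cstar" "is_cadjoint a b" by (rule reduced_cstar_cadjoint[OF a])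
  \<comment> \<open>Twice the real and twice the imaginary part of \<open>a\<close>: both are
    self-adjoint, and \<open>2 a = h + i k\<close>.\<close>
  define h where "h = a + b"
  define k where "k = scaleC_op (- \<i>) (a - b)"
  have ba: "is_cadjoint b a" by (rule is_cadjoint_sym[OF b(2)])
  have nb: "norm b \<le> norm a" by (rule norm_cadjoint_le[OF b(2)])
  have h: "h \<in> reduced_cstar" "is_cadjoint h h" "norm h \<le> 2 * norm a"
    using reduced_cstar_add[OF a b(1)] is_cadjoint_add[OF b(2) ba] nb norm_triangle_ineq[of a b]
    by (auto simp: h_def add.commute)
  have "is_cadjoint k (scaleC_op (cnj (- \<i>)) (b - a))"
    unfolding k_def by (rule is_cadjoint_scaleC[OF is_cadjoint_diff[OF b(2) ba]])
  also have "scaleC_op (cnj (- \<i>)) (b - a) = scaleC_op (- \<i>) ((-1) *\<^sub>R (b - a))"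
    by (simp only: scaleC_op_scaleR[symmetric] scaleC_op_scaleC) simp
  also have "\<dots> = k" by (simp add: k_def)
  finally have k: "k \<in> reduced_cstar" "is_cadjoint k k" "norm k \<le> 2 * norm a"
    using reduced_cstar_scaleC[OF reduced_cstar_diff[OF a b(1)], of "- \<i>"] nb
      norm_triangle_ineq4[of a b] norm_scaleC_op_le[of "- \<i>" "a - b"]
    by (auto simp: k_def)
  have "\<sigma> h = \<sigma> a + \<sigma> b" "\<sigma> k = - \<i> * (\<sigma> a - \<sigma> b)"
    by (simp_all only: h_def k_def state_add[OF \<sigma> a b(1)] state_diff[OF \<sigma> a b(1)]
        state_scaleC[OF \<sigma> reduced_cstar_diff[OF a b(1)]])
  moreover have "\<i> * (- \<i> * z) = z" for z by (simp flip: mult.assoc)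
  ultimately have "cmod (2 * \<sigma> a) \<le> cmod (\<sigma> h) + cmod (\<i> * \<sigma> k)"
    using norm_triangle_ineq[of "\<sigma> h" "\<i> * \<sigma> k"] by simp
  then have "2 * cmod (\<sigma> a) \<le> cmod (\<sigma> h) + cmod (\<sigma> k)"
    by (simp add: norm_mult)
  then show ?thesis
    using state_self_adjoint_bound[OF \<sigma> h(1,2)] state_self_adjoint_bound[OF \<sigma> k(1,2)] h(3) k(3)
    by linarith
qed

lemma state_left_regular_bound:
  "\<sigma> \<in> state_space reduced_cstar \<Longrightarrow> cmod (\<sigma> (left_regular g)) \<le> 2"
  using state_bound[OF _ left_regular_in_reduced_cstar] norm_left_regular_le[of g]
  by (smt (verit, best))

section \<open>The weak* topology\<close>

lemma topspace_state_topology: "topspace (state_topology A) = state_space A"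
  by (auto simp: state_topology_def state_space_def extensional_def PiE_def)

lemma continuous_map_state_eval:
  "a \<in> A \<Longrightarrow> continuous_map (state_topology A) euclidean (\<lambda>\<sigma>. \<sigma> a)"
  unfolding state_topology_def
  by (intro continuous_map_from_subtopology continuous_map_product_projection)

text \<open>Every clause of the definition equates two continuous functions of \<open>\<phi>\<close>
  or pulls back a closed set along one. The closure assumptions keep the points of evaluation in
  \<open>A\<close>, where evaluation is a coordinate projection.\<close>

lemma closedin_state_space:
  fixes A :: "'g op set"
  assumes add: "\<And>a b. a \<in> A \<Longrightarrow> b \<in> A \<Longrightarrow> a + b \<in> A"
    and scale: "\<And>c a. a \<in> A \<Longrightarrow> scaleC_op c a \<in> A"
    and nonneg: "\<And>a. a \<in> A \<Longrightarrow> cadjoint a o\<^sub>L a \<in> A"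
    and id: "id_blinfun \<in> A"
  shows "closedin (product_topology (\<lambda>_. euclidean) A) (state_space A)"
proof -
  let ?P = "product_topology (\<lambda>_. euclidean :: complex topology) A"
  have ev: "continuous_map ?P euclidean (\<lambda>\<phi>. \<phi> a)" if "a \<in> A" for a
    by (rule continuous_map_product_projection[OF that])
  have eq: "closedin ?P {\<phi> \<in> topspace ?P. f \<phi> = g \<phi>}"
    if "continuous_map ?P euclidean f" "continuous_map ?P euclidean g" for f g :: "_ \<Rightarrow> complex"
    using that by (intro closedin_continuous_maps_eq[of euclidean]) auto
  have 1: "closedin ?P {\<phi> \<in> topspace ?P. \<phi> (a + b) = \<phi> a + \<phi> b}" if "a \<in> A" "b \<in> A" for a b
    using that by (intro eq continuous_map_add ev add)
  have 2: "closedin ?P {\<phi> \<in> topspace ?P. \<phi> (scaleC_op c a) = c * \<phi> a}" if "a \<in> A" for a c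
  proof (intro eq ev scale that)
    have "continuous_map ?P euclidean ((*) c \<circ> (\<lambda>\<phi>. \<phi> a))"
      by (rule continuous_map_compose[OF ev[OF that]]) (auto intro: continuous_intros)
    then show "continuous_map ?P euclidean (\<lambda>\<phi>. c * \<phi> a)" by (simp add: o_def)
  qed
  have 3: "closedin ?P {\<phi> \<in> topspace ?P. \<phi> (cadjoint a o\<^sub>L a) \<in> \<real>\<^sub>\<ge>\<^sub>0}" if "a \<in> A" for a
    using that by (intro closedin_continuous_map_preimage[OF ev[OF nonneg]]) auto
  have 4: "closedin ?P {\<phi> \<in> topspace ?P. \<phi> id_blinfun = 1}"
    by (intro eq ev id) auto
  have "state_space A =
    (\<Inter>p\<in>A \<times> A. {\<phi> \<in> topspace ?P. \<phi> (fst p + snd p) = \<phi> (fst p) + \<phi> (snd p)}) \<inter>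
    (\<Inter>p\<in>UNIV \<times> A. {\<phi> \<in> topspace ?P. \<phi> (scaleC_op (fst p) (snd p)) = fst p * \<phi> (snd p)}) \<inter>
    (\<Inter>a\<in>A. {\<phi> \<in> topspace ?P. \<phi> (cadjoint a o\<^sub>L a) \<in> \<real>\<^sub>\<ge>\<^sub>0}) \<inter>
    {\<phi> \<in> topspace ?P. \<phi> id_blinfun = 1}"
    (is "_ = ?R")
  proof (intro equalityI subsetI)
    fix \<phi> assume "\<phi> \<in> ?R" then show "\<phi> \<in> state_space A"
      by (fastforce simp: state_space_def PiE_def)
  qed (auto simp: state_space_def PiE_def)
  moreover have "closedin ?P ?R"
    by (intro closedin_Int closedin_INT 1 2 3 4) (use id in auto)
  ultimately show ?thesis by simp
qed

text \<open>The Banach-Alaoglu argument: by \<open>state_bound\<close> the states form a closed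
  subset of a product of discs of radius \<open>2 * norm a\<close>, which is compact by Tychonoff's
  theorem.\<close>

lemma compact_space_state_topology:
  "compact_space (state_topology (reduced_cstar :: 'g::group_add op set))"
proof -
  let ?A = "reduced_cstar :: 'g op set"
  let ?P = "product_topology (\<lambda>_. euclidean :: complex topology) ?A"
  have "compactin ?P (PiE ?A (\<lambda>a. cball 0 (2 * norm a)))"
    by (simp add: compactin_PiE)
  moreover have "state_space ?A \<subseteq> PiE ?A (\<lambda>a. cball 0 (2 * norm a))"
    by (auto simp: PiE_def Pi_def state_bound) (simp add: state_space_def)
  moreover have "cadjoint a o\<^sub>L a \<in> ?A" if a: "a \<in> ?A" for a
  proof -
    obtain b where "b \<in> ?A" "is_cadjoint a b" by (rule reduced_cstar_cadjoint[OF a])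
    then show ?thesis using cadjoint_eqI[of a b] a by (auto intro: reduced_cstar_compose)
  qed
  then have "closedin ?P (state_space ?A)"
    by (intro closedin_state_space)
      (auto intro: reduced_cstar_add reduced_cstar_scaleC id_in_reduced_cstar)
  ultimately have "compactin ?P (state_space ?A)" by (rule closed_compactin)
  then show ?thesis by (auto simp: state_topology_def compactin_subspace)
qed

text \<open>States are uniformly bounded, so the unitaries of the group determine the uniformity of the
  weak* topology.\<close>

lemma state_close_if_close_on_group:
  fixes a :: "'g::group_add op"
  assumes a: "a \<in> reduced_cstar" and e: "e > 0"
  shows "\<exists>G \<delta>. finite G \<and> \<delta> > 0 \<and> (\<forall>\<sigma>\<in>state_space reduced_cstar. \<forall>\<tau>\<in>state_space reduced_cstar.
    (\<forall>g\<in>G. cmod (\<tau> (left_regular g) - \<sigma> (left_regular g)) < \<delta>) \<longrightarrow> cmod (\<tau> a - \<sigma> a) < e)"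
proof -
  \<comment> \<open>Replacing \<open>a\<close> by \<open>b\<close> costs less than
    \<open>2 * e / 8 = e / 4\<close> for each of the two states, by \<open>state_bound\<close>; the
    other \<open>e / 2\<close> is left for the values on the group.\<close>
  obtain b where b: "b \<in> group_algebra" "dist b a < e / 8"
    using a e unfolding reduced_cstar_def closure_approachable
    by (meson divide_pos_pos zero_less_numeral)
  obtain G c where G: "finite G" "b = (\<Sum>g\<in>G. scaleC_op (c g) (left_regular g))"
    using b(1) unfolding group_algebra_def by blast
  have bA: "b \<in> reduced_cstar" using b(1) group_algebra_subset_reduced_cstar by blast
  \<comment> \<open>The summand 1 keeps \<open>C\<close> positive and the final estimate strict even
    if all coefficients vanish.\<close>
  define C where "C = 1 + (\<Sum>g\<in>G. cmod (c g))"
  have C: "C > 0" by (simp add: C_def add_pos_nonneg sum_nonneg)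
  have "cmod (\<tau> a - \<sigma> a) < e"
    if \<sigma>: "\<sigma> \<in> state_space reduced_cstar" and \<tau>: "\<tau> \<in> state_space reduced_cstar"
      and close: "\<forall>g\<in>G. cmod (\<tau> (left_regular g) - \<sigma> (left_regular g)) < e / (2 * C)" for \<sigma> \<tau>
  proof -
    have diff: "cmod (\<rho> b - \<rho> a) < e / 4" if "\<rho> \<in> state_space reduced_cstar" for \<rho>
      using state_bound[OF that reduced_cstar_diff[OF bA a]] b(2) state_diff[OF that bA a]
      by (simp add: dist_norm)
    have "\<tau> b - \<sigma> b = (\<Sum>g\<in>G. c g * (\<tau> (left_regular g) - \<sigma> (left_regular g)))"
      unfolding G(2) state_sum_group_algebra[OF \<sigma>] state_sum_group_algebra[OF \<tau>]
      by (simp add: sum_subtractf right_diff_distrib)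
    also have "cmod \<dots> \<le> (\<Sum>g\<in>G. cmod (c g) * (e / (2 * C)))"
      using close unfolding norm_mult
      by (intro sum_norm_le) (simp only: norm_mult, intro mult_left_mono, auto intro: less_imp_le)
    also have "\<dots> = (C - 1) * (e / (2 * C))"
      unfolding sum_distrib_right[symmetric] by (simp add: C_def)
    also have "\<dots> < C * (e / (2 * C))" using C e by (intro mult_strict_right_mono) auto
    also have "\<dots> = e / 2" using C by simp
    finally have "cmod (\<tau> b - \<sigma> b) < e / 2" .
    moreover have "cmod (\<tau> a - \<sigma> a) = cmod ((\<tau> b - \<sigma> b) - (\<tau> b - \<tau> a) + (\<sigma> b - \<sigma> a))"
      by (rule arg_cong[where f = cmod]) simp
    ultimately show ?thesis
      using diff[OF \<sigma>] diff[OF \<tau>] norm_triangle_ineq[of "(\<tau> b - \<sigma> b) - (\<tau> b - \<tau> a)" "\<sigma> b - \<sigma> a"]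
        norm_triangle_ineq4[of "\<tau> b - \<sigma> b" "\<tau> b - \<tau> a"] by linarith
  qed
  then show ?thesis using G(1) C e by (intro exI[of _ G] exI[of _ "e / (2 * C)"]) auto
qed

text \<open>Only values at group elements enter, since the shift acts on these by an explicit
  formula. For finite \<open>G\<close> and positive \<open>\<delta>\<close> these sets form a
  neighbourhood base at a state \<open>\<sigma>\<close>.\<close>

definition group_ball :: "'g::group_add set \<Rightarrow> real \<Rightarrow> ('g op \<Rightarrow> complex) \<Rightarrow> ('g op \<Rightarrow> complex) set" where
  "group_ball G \<delta> \<sigma> = {\<tau> \<in> state_space reduced_cstar.
     \<forall>g\<in>G. cmod (\<tau> (left_regular g) - \<sigma> (left_regular g)) < \<delta>}"

lemma openin_group_ball:
  fixes G :: "'g::group_add set"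
  assumes "finite G" shows "openin (state_topology reduced_cstar) (group_ball G \<delta> \<sigma>)"
proof -
  let ?X = "state_topology (reduced_cstar :: 'g op set)"
  have *: "openin ?X {\<tau> \<in> topspace ?X. \<tau> (left_regular g) \<in> ball (\<sigma> (left_regular g)) \<delta>}" for g
    by (rule openin_continuous_map_preimage[OF continuous_map_state_eval])
      (auto simp: left_regular_in_reduced_cstar)
  have "group_ball G \<delta> \<sigma> = topspace ?X \<inter>
      \<Inter>((\<lambda>g. {\<tau> \<in> topspace ?X. \<tau> (left_regular g) \<in> ball (\<sigma> (left_regular g)) \<delta>}) ` G)"
    by (auto simp: group_ball_def topspace_state_topology dist_norm norm_minus_commute)
  also have "openin ?X \<dots>"
    using * assms by (cases "G = {}") (auto intro!: openin_Int openin_Inter)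
  finally show ?thesis .
qed

text \<open>A basic open set of the product constrains only finitely many coordinates. Each
  constraint follows from closeness on finitely many group elements, so the union of these finite
  sets and the smallest tolerance suffice.\<close>

lemma group_ball_subset_open:
  fixes U :: "('g::group_add op \<Rightarrow> complex) set"
  assumes U: "openin (state_topology reduced_cstar) U" and \<sigma>: "\<sigma> \<in> U"
  obtains G \<delta> where "finite G" "\<delta> > 0" "group_ball G \<delta> \<sigma> \<subseteq> U"
proof -
  let ?A = "reduced_cstar :: 'g op set"
  let ?P = "product_topology (\<lambda>_. euclidean :: complex topology) ?A"
  obtain W where W: "openin ?P W" "U = W \<inter> state_space ?A"
    using U by (auto simp: state_topology_def openin_subtopology)
  obtain V where V: "finite {a \<in> ?A. V a \<noteq> UNIV}" "\<forall>a\<in>?A. open (V a)" "\<sigma> \<in> PiE ?A V" "PiE ?A V \<subseteq> W"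
    using W \<sigma> unfolding openin_product_topology_alt by auto
  let ?F = "{a \<in> ?A. V a \<noteq> UNIV}"
  have "\<forall>a\<in>?F. \<exists>p. finite (fst p) \<and> snd p > 0 \<and>
      (\<forall>\<tau>\<in>state_space ?A. (\<forall>g\<in>fst p. cmod (\<tau> (left_regular g) - \<sigma> (left_regular g)) < snd p) \<longrightarrow> \<tau> a \<in> V a)"
  proof
    fix a assume a: "a \<in> ?F"
    then have "\<sigma> a \<in> V a" "open (V a)" using V by auto
    then obtain e where e: "e > 0" "ball (\<sigma> a) e \<subseteq> V a" using open_contains_ball by blast
    obtain G \<delta> where "finite G" "\<delta> > 0" and *: "\<forall>\<sigma>\<in>state_space ?A. \<forall>\<tau>\<in>state_space ?A.
       (\<forall>g\<in>G. cmod (\<tau> (left_regular g) - \<sigma> (left_regular g)) < \<delta>) \<longrightarrow> cmod (\<tau> a - \<sigma> a) < e"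
      using state_close_if_close_on_group[of a e] a e(1) by blast
    moreover have "\<tau> a \<in> V a" if "\<tau> \<in> state_space ?A"
      "\<forall>g\<in>G. cmod (\<tau> (left_regular g) - \<sigma> (left_regular g)) < \<delta>" for \<tau>
      using * that e(2) W(2) \<sigma> by (auto simp: subset_iff dist_norm norm_minus_commute)
    ultimately show "\<exists>p. finite (fst p) \<and> snd p > 0 \<and>
      (\<forall>\<tau>\<in>state_space ?A. (\<forall>g\<in>fst p. cmod (\<tau> (left_regular g) - \<sigma> (left_regular g)) < snd p) \<longrightarrow> \<tau> a \<in> V a)"
      by (intro exI[of _ "(G, \<delta>)"]) simp
  qed
  from bchoice[OF this] obtain p where p: "\<And>a. a \<in> ?F \<Longrightarrow> finite (fst (p a)) \<and> snd (p a) > 0 \<and>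
      (\<forall>\<tau>\<in>state_space ?A. (\<forall>g\<in>fst (p a). cmod (\<tau> (left_regular g) - \<sigma> (left_regular g)) < snd (p a)) \<longrightarrow> \<tau> a \<in> V a)"
    by blast
  define G where "G = (\<Union>a\<in>?F. fst (p a))"
  \<comment> \<open>Inserting 1 keeps the minimum meaningful when no coordinate is
    constrained.\<close>
  define \<delta> where "\<delta> = Min (insert 1 ((\<lambda>a. snd (p a)) ` ?F))"
  have fin: "finite (insert 1 ((\<lambda>a. snd (p a)) ` ?F))" using V(1) by simp
  have "finite G" using V(1) p unfolding G_def by blast
  moreover have "\<delta> > 0" unfolding \<delta>_def using p by (subst Min_gr_iff[OF fin]) auto
  moreover have "group_ball G \<delta> \<sigma> \<subseteq> U"
  proof
    fix \<tau> assume "\<tau> \<in> group_ball G \<delta> \<sigma>"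
    then have \<tau>: "\<tau> \<in> state_space ?A"
      and close: "\<And>g. g \<in> G \<Longrightarrow> cmod (\<tau> (left_regular g) - \<sigma> (left_regular g)) < \<delta>"
      by (auto simp: group_ball_def)
    have "\<tau> a \<in> V a" if a: "a \<in> ?A" for a
    proof (cases "V a = UNIV")
      case False
      then have aF: "a \<in> ?F" using a by simp
      have "\<delta> \<le> snd (p a)" unfolding \<delta>_def using aF by (intro Min_le[OF fin]) auto
      then have "\<forall>g\<in>fst (p a). cmod (\<tau> (left_regular g) - \<sigma> (left_regular g)) < snd (p a)"
        using close aF by (force simp: G_def)
      then show ?thesis using p[OF aF] \<tau> by blast
    qed simp
    then have "\<tau> \<in> PiE ?A V" using \<tau> by (auto simp: PiE_def state_space_def)
    then show "\<tau> \<in> U" using V(4) W(2) \<tau> by blast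
  qed
  ultimately show ?thesis by (rule that)
qed

text \<open>The usual Lebesgue number argument: by compactness finitely many balls of half the
  radius cover, and the triangle inequality puts a small ball around any state into the full ball
  around one of the centres.\<close>

lemma lebesgue_number_states:
  fixes \<U> :: "('g::group_add op \<Rightarrow> complex) set set"
  assumes "finite_open_cover (state_topology reduced_cstar) \<U>"
  obtains G \<delta> where "finite G" "\<delta> > 0"
    "\<And>\<sigma>. \<sigma> \<in> state_space reduced_cstar \<Longrightarrow> \<exists>U\<in>\<U>. group_ball G \<delta> \<sigma> \<subseteq> U"
proof -
  let ?S = "state_space (reduced_cstar :: 'g op set)"
  let ?X = "state_topology (reduced_cstar :: 'g op set)"
  have "\<forall>\<sigma>\<in>?S. \<exists>p. finite (fst p) \<and> snd p > 0 \<and> (\<exists>U\<in>\<U>. group_ball (fst p) (snd p) \<sigma> \<subseteq> U)"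
  proof
    fix \<sigma> assume "\<sigma> \<in> ?S"
    then obtain U where U: "U \<in> \<U>" "\<sigma> \<in> U" "openin ?X U"
      using assms by (auto simp: finite_open_cover_def topspace_state_topology)
    obtain G \<delta> where "finite G" "\<delta> > 0" "group_ball G \<delta> \<sigma> \<subseteq> U"
      by (rule group_ball_subset_open[OF U(3,2)])
    then show "\<exists>p. finite (fst p) \<and> snd p > 0 \<and> (\<exists>U\<in>\<U>. group_ball (fst p) (snd p) \<sigma> \<subseteq> U)"
      using U(1) by (intro exI[of _ "(G, \<delta>)"]) auto
  qed
  then obtain p where p: "\<And>\<sigma>. \<sigma> \<in> ?S \<Longrightarrow> finite (fst (p \<sigma>)) \<and> snd (p \<sigma>) > 0 \<and>
      (\<exists>U\<in>\<U>. group_ball (fst (p \<sigma>)) (snd (p \<sigma>)) \<sigma> \<subseteq> U)" by metis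
  define N where "N \<sigma> = group_ball (fst (p \<sigma>)) (snd (p \<sigma>) / 2) \<sigma>" for \<sigma>
  have "\<forall>V\<in>N ` ?S. openin ?X V" using p by (auto simp: N_def intro: openin_group_ball)
  moreover have "topspace ?X \<subseteq> \<Union>(N ` ?S)"
    using p by (fastforce simp: N_def group_ball_def topspace_state_topology)
  ultimately obtain \<F> where \<F>: "finite \<F>" "\<F> \<subseteq> N ` ?S" "topspace ?X \<subseteq> \<Union>\<F>"
    using compact_space_state_topology unfolding compact_space_alt by metis
  then obtain C where C: "C \<subseteq> ?S" "finite C" "\<F> = N ` C" by (meson finite_subset_image)
  define G where "G = (\<Union>\<sigma>\<in>C. fst (p \<sigma>))"
  define \<delta> where "\<delta> = Min (insert 1 ((\<lambda>\<sigma>. snd (p \<sigma>) / 2) ` C))"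
  have fin: "finite (insert 1 ((\<lambda>\<sigma>. snd (p \<sigma>) / 2) ` C))" using C(2) by simp
  have "finite G" using C p unfolding G_def by blast
  moreover have "\<delta> > 0" unfolding \<delta>_def using p C(1) by (subst Min_gr_iff[OF fin]) auto
  moreover have "\<exists>U\<in>\<U>. group_ball G \<delta> \<sigma> \<subseteq> U" if \<sigma>: "\<sigma> \<in> ?S" for \<sigma>
  proof -
    obtain \<rho> where \<rho>: "\<rho> \<in> C" "\<sigma> \<in> N \<rho>"
      using \<F>(3) C(3) \<sigma> by (auto simp: topspace_state_topology)
    obtain U where U: "U \<in> \<U>" "group_ball (fst (p \<rho>)) (snd (p \<rho>)) \<rho> \<subseteq> U"
      using p \<rho>(1) C(1) by blast
    have "\<tau> \<in> group_ball (fst (p \<rho>)) (snd (p \<rho>)) \<rho>" if \<tau>: "\<tau> \<in> group_ball G \<delta> \<sigma>" for \<tau>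
    proof -
      have "cmod (\<tau> (left_regular g) - \<rho> (left_regular g)) < snd (p \<rho>)" if g: "g \<in> fst (p \<rho>)" for g
      proof -
        have "\<delta> \<le> snd (p \<rho>) / 2" unfolding \<delta>_def using \<rho>(1) by (intro Min_le[OF fin]) auto
        moreover have "cmod (\<tau> (left_regular g) - \<sigma> (left_regular g)) < \<delta>"
          using \<tau> g \<rho>(1) by (auto simp: group_ball_def G_def)
        moreover have "cmod (\<sigma> (left_regular g) - \<rho> (left_regular g)) < snd (p \<rho>) / 2"
          using \<rho>(2) g by (auto simp: group_ball_def N_def)
        ultimately show ?thesis
          using norm_triangle_ineq[of "\<tau> (left_regular g) - \<sigma> (left_regular g)"
              "\<sigma> (left_regular g) - \<rho> (left_regular g)"] by simp
      qed
      then show ?thesis using \<tau> by (auto simp: group_ball_def)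
    qed
    then show ?thesis using U by blast
  qed
  ultimately show ?thesis by (rule that)
qed

section \<open>Free families of group elements\<close>

text \<open>Signs are forgotten, so that inversion changes nothing and disjoint sets of letters rule
  out cancellation.\<close>

definition letters :: "'a free_group \<Rightarrow> 'a set" where
  "letters g = fst ` set (word_of g)"

text \<open>The empty word belongs to none of these sets, and disjoint blocks \<open>B\<close> give
  disjoint sets.\<close>

definition starting_in :: "'a set \<Rightarrow> 'a free_group set" where
  "starting_in B = {h. word_of h \<noteq> [] \<and> fst (hd (word_of h)) \<in> B}"

section \<open>Products without cancellation\<close>

lemma finite_letters: "finite (letters g)"
  by (simp add: letters_def)

lemma letters_uminus: "letters (- g) = letters g"
  by (auto simp: letters_def uminus_free_group.rep_eq flip_def image_image)

text \<open>Cancellation could only begin where the words meet, and there the last letter of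
  \<open>u\<close> has its index in \<open>B\<close> while the first letter of \<open>v\<close> does
  not.\<close>

lemma foldr_lmul_append:
  assumes "reduced_word u" "reduced_word v" "fst ` set u \<subseteq> B" "v \<noteq> [] \<Longrightarrow> fst (hd v) \<notin> B"
  shows "reduced_word (u @ v)" "foldr lmul u v = u @ v"
proof -
  have "reduced_word (u @ v) \<and> foldr lmul u v = u @ v"
    using assms(1,3)
  proof (induction u)
    case (Cons x u)
    then have IH: "reduced_word (u @ v)" "foldr lmul u v = u @ v"
      by (auto simp: reduced_Cons)
    have "hd (u @ v) \<noteq> flip x" if "u @ v \<noteq> []"
      using that Cons.prems assms(4)
      by (cases u) (auto simp: reduced_Cons flip_def)
    then have "reduced_word (x # u @ v)" using IH(1) by (auto simp: reduced_Cons)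
    then show ?case using IH(2) by (simp add: lmul_reduced)
  qed (use assms(2) in simp)
  then show "reduced_word (u @ v)" "foldr lmul u v = u @ v" by auto
qed

text \<open>A ping-pong step: nothing cancels in \<open>g + h\<close>, so it begins with the first
  letter of \<open>g\<close>.\<close>

lemma add_starting_in:
  assumes "g \<noteq> 0" "letters g \<subseteq> B" "h \<notin> starting_in B"
  shows "g + h \<in> starting_in B"
proof -
  have "word_of (g + h) = word_of g @ word_of h"
    unfolding plus_free_group.rep_eq
    by (rule foldr_lmul_append(2)[where B = B])
      (use assms(2,3) word_of[of g] word_of[of h] in \<open>auto simp: letters_def starting_in_def\<close>)
  moreover have "word_of g \<noteq> []"
    using assms(1) by (metis word_of_inject zero_free_group.rep_eq)
  moreover have "fst (hd (word_of g)) \<in> B"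
    using \<open>word_of g \<noteq> []\<close> assms(2) by (auto simp: letters_def)
  ultimately show ?thesis by (simp add: starting_in_def)
qed

section \<open>Restrictions of square-summable functions\<close>

lift_definition restrict_ell2 :: "'g set \<Rightarrow> 'g ell2 \<Rightarrow> 'g ell2"
  is "\<lambda>W f x. if x \<in> W then f x else 0"
  by (erule summable_on_comparison_test) auto

lemma norm_le_if_nth_le:
  assumes "\<And>x. cmod (ell2_nth f x) \<le> cmod (ell2_nth g x)"
  shows "norm f \<le> norm g"
proof -
  have "(norm f)\<^sup>2 \<le> (norm g)\<^sup>2"
    unfolding norm_ell2_sq by (intro infsum_mono ell2_nth_summable power_mono assms) simp
  then show ?thesis by (rule power2_le_imp_le) simp
qed

lemma norm_restrict_le: "norm (restrict_ell2 W f) \<le> norm f"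
  by (rule norm_le_if_nth_le) (simp add: restrict_ell2.rep_eq)

lemma restrict_add_restrict_Compl: "restrict_ell2 W f + restrict_ell2 (- W) f = f"
  by transfer auto

text \<open>Disjoint supports make every term of the inner product vanish. The scalars match the
  summands of \<open>P\<close> in \<open>norm_sum_free_family_le\<close>.\<close>

lemma orthogonal_restrict:
  assumes "W \<inter> V = {}"
  shows "orthogonal (scaleC_ell2 c (restrict_ell2 W f)) (scaleC_ell2 d (restrict_ell2 V h))"
proof -
  have *: "cnj (ell2_nth (scaleC_ell2 c (restrict_ell2 W f)) x) *
      ell2_nth (scaleC_ell2 d (restrict_ell2 V h)) x = 0" for x
    using assms by (auto simp: scaleC_ell2.rep_eq restrict_ell2.rep_eq)
  show ?thesis unfolding orthogonal_def inner_ell2_def cinner_def * by simp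
qed

lemma ell2_nth_sum: "ell2_nth (\<Sum>i\<in>I. f i) x = (\<Sum>i\<in>I. ell2_nth (f i) x)"
  by (induction I rule: infinite_finite_induct) (auto simp: zero_ell2.rep_eq plus_ell2.rep_eq)

lemma scaleC_ell2_1: "scaleC_ell2 1 f = f"
  by transfer simp

text \<open>Bessel's inequality: the restrictions are orthogonal, and their sum is \<open>f\<close>
  cut off to the union of the \<open>W i\<close>.\<close>

lemma sum_norm_restrict_le:
  assumes I: "finite I" and disj: "pairwise (\<lambda>i j. W i \<inter> W j = {}) I"
  shows "(\<Sum>i\<in>I. (norm (restrict_ell2 (W i) f))\<^sup>2) \<le> (norm f)\<^sup>2"
proof -
  have "pairwise (\<lambda>i j. orthogonal (restrict_ell2 (W i) f) (restrict_ell2 (W j) f)) I"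
    using disj orthogonal_restrict[of _ _ 1 f 1 f]
    by (auto simp: pairwise_def scaleC_ell2_1)
  then have eq: "(\<Sum>i\<in>I. (norm (restrict_ell2 (W i) f))\<^sup>2) = (norm (\<Sum>i\<in>I. restrict_ell2 (W i) f))\<^sup>2"
    by (rule norm_sum_Pythagorean[OF I, symmetric])
  have "norm (\<Sum>i\<in>I. restrict_ell2 (W i) f) \<le> norm f"
  proof (rule norm_le_if_nth_le)
    fix x
    show "cmod (ell2_nth (\<Sum>i\<in>I. restrict_ell2 (W i) f) x) \<le> cmod (ell2_nth f x)"
    proof (cases "\<exists>j\<in>I. x \<in> W j")
      case True
      then obtain j where j: "j \<in> I" "x \<in> W j" by blast
      have "(\<Sum>i\<in>I. ell2_nth (restrict_ell2 (W i) f) x) = (\<Sum>i\<in>I. if i = j then ell2_nth f x else 0)"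
        using j disj by (intro sum.cong) (auto simp: restrict_ell2.rep_eq pairwise_def)
      then show ?thesis using j I by (simp add: ell2_nth_sum)
    next
      case False
      then have "(\<Sum>i\<in>I. ell2_nth (restrict_ell2 (W i) f) x) = 0"
        by (intro sum.neutral) (auto simp: restrict_ell2.rep_eq)
      then show ?thesis by (simp add: ell2_nth_sum)
    qed
  qed
  then show ?thesis unfolding eq by (rule power_mono) simp
qed

text \<open>Leinert's inequality. Let \<open>W i\<close> be the words starting in the block \<open>B i\<close>.
  The part of \<open>g i + h\<close> inside \<open>W i\<close> contributes orthogonal summands, and \<open>g i + h\<close> can only lie
  outside \<open>W i\<close> if \<open>h\<close> is in \<open>W i\<close>, so the remaining part is a sum of vectors controlled by the
  orthogonal restrictions of the argument.\<close>

lemma norm_sum_free_family_le: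
  fixes g :: "'i \<Rightarrow> 'a free_group"
  assumes I: "finite I" and g: "\<And>i. i \<in> I \<Longrightarrow> g i \<noteq> 0" "\<And>i. i \<in> I \<Longrightarrow> letters (g i) \<subseteq> B i"
    and disj: "pairwise (\<lambda>i j. B i \<inter> B j = {}) I"
  shows "norm (\<Sum>i\<in>I. scaleC_op (c i) (left_regular (g i))) \<le> 2 * L2_set (\<lambda>i. cmod (c i)) I"
proof (rule norm_blinfun_bound)
  fix f :: "'a free_group ell2"
  define W where "W i = starting_in (B i)" for i
  define y where "y i = left_translate (g i) f" for i
  define P where "P = (\<Sum>i\<in>I. scaleC_ell2 (c i) (restrict_ell2 (W i) (y i)))"
  define Q where "Q = (\<Sum>i\<in>I. scaleC_ell2 (c i) (restrict_ell2 (- W i) (y i)))"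
  have W: "pairwise (\<lambda>i j. W i \<inter> W j = {}) I"
    using disj by (auto simp: pairwise_def W_def starting_in_def)
  have norm_y: "norm (y i) = norm f" for i
    by (simp add: y_def left_translate_conv_permute norm_permute_ell2)
  have split: "(\<Sum>i\<in>I. scaleC_op (c i) (left_regular (g i))) f = P + Q"
    by (simp add: P_def Q_def y_def sum.distrib[symmetric] scaleC_ell2_add[symmetric]
        restrict_add_restrict_Compl blinfun.sum_left)
  have "(norm P)\<^sup>2 = (\<Sum>i\<in>I. (norm (scaleC_ell2 (c i) (restrict_ell2 (W i) (y i))))\<^sup>2)"
    unfolding P_def using W
    by (intro norm_sum_Pythagorean[OF I]) (auto simp: pairwise_def intro: orthogonal_restrict)
  also have "\<dots> \<le> (\<Sum>i\<in>I. (cmod (c i))\<^sup>2 * (norm f)\<^sup>2)"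
    unfolding norm_scaleC_ell2 power_mult_distrib
    by (intro sum_mono mult_left_mono power_mono order_trans[OF norm_restrict_le])
      (auto simp: norm_y)
  also have "\<dots> = (L2_set (\<lambda>i. cmod (c i)) I * norm f)\<^sup>2"
    by (simp add: sum_distrib_right[symmetric] L2_set_def power_mult_distrib sum_nonneg)
  finally have P: "norm P \<le> L2_set (\<lambda>i. cmod (c i)) I * norm f"
    by (rule power2_le_imp_le) simp
  have Qi: "norm (restrict_ell2 (- W i) (y i)) \<le> norm (restrict_ell2 (W i) f)" if i: "i \<in> I" for i
  proof -
    have "norm (restrict_ell2 (- W i) (y i)) \<le> norm (left_translate (g i) (restrict_ell2 (W i) f))"
    proof (rule norm_le_if_nth_le)
      fix h
      \<comment> \<open>The inverse \<open>- g i\<close> has the same letters, so adding it to a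
        word that does not start in \<open>B i\<close> gives one that does. Hence cutting
        \<open>f\<close> down to \<open>W i\<close> before translating loses nothing outside
        \<open>W i\<close>.\<close>
      have "- g i + h \<in> W i" if "h \<notin> W i"
        using that g[OF i] by (auto simp: W_def letters_uminus intro!: add_starting_in)
      then show "cmod (ell2_nth (restrict_ell2 (- W i) (y i)) h)
          \<le> cmod (ell2_nth (left_translate (g i) (restrict_ell2 (W i) f)) h)"
        by (simp add: restrict_ell2.rep_eq left_translate.rep_eq y_def)
    qed
    then show ?thesis by (simp add: left_translate_conv_permute norm_permute_ell2)
  qed
  have "norm Q \<le> (\<Sum>i\<in>I. \<bar>cmod (c i)\<bar> * \<bar>norm (restrict_ell2 (W i) f)\<bar>)"
    unfolding Q_def
    by (rule sum_norm_le) (auto simp: norm_scaleC_ell2 intro!: mult_left_mono Qi)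
  \<comment> \<open>Cauchy-Schwarz; Bessel's inequality then bounds the second factor.\<close>
  also have "\<dots> \<le> L2_set (\<lambda>i. cmod (c i)) I * L2_set (\<lambda>i. norm (restrict_ell2 (W i) f)) I"
    by (rule L2_set_mult_ineq)
  also have "L2_set (\<lambda>i. norm (restrict_ell2 (W i) f)) I \<le> norm f"
    unfolding L2_set_def by (rule real_le_lsqrt) (auto intro: sum_norm_restrict_le[OF I W])
  finally have "norm Q \<le> L2_set (\<lambda>i. cmod (c i)) I * norm f"
    by (simp add: mult_left_mono)
  then show "norm ((\<Sum>i\<in>I. scaleC_op (c i) (left_regular (g i))) f)
      \<le> 2 * L2_set (\<lambda>i. cmod (c i)) I * norm f"
    unfolding split using norm_triangle_ineq[of P Q] P by linarith
qed simp

text \<open>The coefficients align the phases, so that \<open>card I * e\<close> is at most the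
  modulus of the state at the combination \<open>a\<close>. By \<open>state_bound\<close> and
  Leinert's inequality this modulus is at most \<open>2 * 2 * sqrt (card I)\<close>, whence the
  constant 16.\<close>

lemma card_large_state_values_free_family:
  fixes g :: "'i \<Rightarrow> 'a free_group"
  assumes \<sigma>: "\<sigma> \<in> state_space reduced_cstar" and I: "finite I" and e: "e > 0"
    and g: "\<And>i. i \<in> I \<Longrightarrow> g i \<noteq> 0" "pairwise (\<lambda>i j. letters (g i) \<inter> letters (g j) = {}) I"
    and large: "\<And>i. i \<in> I \<Longrightarrow> e \<le> cmod (\<sigma> (left_regular (g i)))"
  shows "real (card I) \<le> 16 / e\<^sup>2"
proof -
  define c where "c i = cnj (sgn (\<sigma> (left_regular (g i))))" for i
  define a where "a = (\<Sum>i\<in>I. scaleC_op (c i) (left_regular (g i)))"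
  have c: "cmod (c i) = 1" if "i \<in> I" for i
    using large[OF that] e by (auto simp: c_def norm_sgn)
  have prod: "c i * \<sigma> (left_regular (g i)) = complex_of_real (cmod (\<sigma> (left_regular (g i))))" for i
  proof -
    have "cnj (sgn z) * z = complex_of_real (cmod z)" for z :: complex
      using complex_norm_square[of z]
      by (cases "z = 0") (auto simp: sgn_eq field_simps power2_eq_square)
    then show ?thesis by (simp add: c_def)
  qed
  have "norm a \<le> 2 * L2_set (\<lambda>i. cmod (c i)) I"
    unfolding a_def using I g by (intro norm_sum_free_family_le[where B = "\<lambda>i. letters (g i)"]) auto
  also have "L2_set (\<lambda>i. cmod (c i)) I = sqrt (real (card I))"
    using c by (simp add: L2_set_def)
  finally have norm_a: "norm a \<le> 2 * sqrt (real (card I))" .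
  have "a \<in> reduced_cstar"
    unfolding a_def by (rule subsetD[OF group_algebra_subset_reduced_cstar])
      (intro group_algebra_sum_in group_algebra_scaleC left_regular_in_group_algebra)
  then have "cmod (\<sigma> a) \<le> 4 * sqrt (real (card I))"
    using state_bound[OF \<sigma>, of a] norm_a by linarith
  moreover have "\<sigma> a = complex_of_real (\<Sum>i\<in>I. cmod (\<sigma> (left_regular (g i))))"
    unfolding a_def state_sum_group_algebra[OF \<sigma>] prod by simp
  then have "cmod (\<sigma> a) = (\<Sum>i\<in>I. cmod (\<sigma> (left_regular (g i))))"
    by (simp only: norm_of_real) (simp add: sum_nonneg)
  moreover have "real (card I) * e \<le> (\<Sum>i\<in>I. cmod (\<sigma> (left_regular (g i))))"
    using large by (intro sum_bounded_below) auto
  ultimately have "real (card I) * e \<le> 4 * sqrt (real (card I))" by linarith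
  then have "sqrt (real (card I)) * (sqrt (real (card I)) * e) \<le> sqrt (real (card I)) * 4"
    by (simp add: mult.assoc[symmetric])
  then have "sqrt (real (card I)) * e \<le> 4"
    by (cases "card I = 0") (auto simp: mult_le_cancel_left)
  then have "(sqrt (real (card I)) * e)\<^sup>2 \<le> 4\<^sup>2" using e by (intro power_mono) auto
  then show ?thesis using e by (simp add: power_mult_distrib field_simps)
qed

section \<open>Counting large values along the shift\<close>

lemma shift_word_eq_0_iff: "shift_word k g = 0 \<longleftrightarrow> g = 0"
  by transfer simp

lemma letters_shift_word: "letters (shift_word k g) = (\<lambda>i. i + k) ` letters g"
  unfolding letters_def shift_word.rep_eq by (force simp: image_image case_prod_beta)

text \<open>Sufficiently spread out translates of \<open>g\<close> have disjoint sets of letters, and the positions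
  \<open>i\<close> split into finitely many spread out residue classes.\<close>

lemma card_large_state_values:
  fixes g :: "int free_group"
  assumes g: "g \<noteq> 0" and e: "e > 0"
  obtains K where "\<And>\<sigma> n. \<sigma> \<in> state_space reduced_cstar \<Longrightarrow>
    card {i \<in> {..<n}. e \<le> cmod (\<sigma> (left_regular (shift_word (int i) g)))} \<le> K"
proof -
  have "bdd_above (abs ` letters g)" by (intro bdd_above_finite finite_imageI finite_letters)
  then obtain b where "\<forall>y\<in>abs ` letters g. y \<le> b" unfolding bdd_above_def by blast
  then have b: "\<bar>x\<bar> \<le> b" if "x \<in> letters g" for x using that by simp
  define m where "m = nat b"
  have m: "\<bar>x\<bar> \<le> int m" if "x \<in> letters g" for x
    using b[OF that] unfolding m_def by linarith
  \<comment> \<open>The letters of \<open>g\<close> lie between \<open>-m\<close> and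
    \<open>m\<close>, so two of them differ by less than \<open>N\<close>. Distinct positions
    congruent modulo \<open>N\<close> therefore give translates without common letters.\<close>
  define N where "N = 2 * m + 1"
  \<comment> \<open>The bound for one residue class, from
    \<open>card_large_state_values_free_family\<close>.\<close>
  define L where "L = nat \<lfloor>16 / e\<^sup>2\<rfloor>"
  have "card {i \<in> {..<n}. e \<le> cmod (\<sigma> (left_regular (shift_word (int i) g)))} \<le> N * L"
    if \<sigma>: "\<sigma> \<in> state_space reduced_cstar" for \<sigma> n
  proof -
    define S where "S = {i \<in> {..<n}. e \<le> cmod (\<sigma> (left_regular (shift_word (int i) g)))}"
    have "card {i \<in> S. i mod N = r} \<le> L" for r
    proof -
      have "letters (shift_word (int i) g) \<inter> letters (shift_word (int j) g) = {}"
        if ij: "i mod N = j mod N" "i \<noteq> j" for i j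
      proof -
        have "int N dvd int i - int j" using ij(1) by (metis mod_eq_dvd_iff of_nat_mod)
        moreover have "int i - int j \<noteq> 0" using ij(2) by simp
        ultimately have "int N \<le> \<bar>int i - int j\<bar>" using zdvd_imp_le[of "int N" "\<bar>int i - int j\<bar>"] by simp
        moreover have "\<bar>x - y\<bar> \<le> 2 * int m" if "x \<in> letters g" "y \<in> letters g" for x y
          using m[OF that(1)] m[OF that(2)] by linarith
        ultimately show ?thesis by (fastforce simp: letters_shift_word N_def)
      qed
      then have "real (card {i \<in> S. i mod N = r}) \<le> 16 / e\<^sup>2"
        using g by (intro card_large_state_values_free_family[OF \<sigma> _ e,
              where g = "\<lambda>i. shift_word (int i) g"])
          (auto simp: S_def shift_word_eq_0_iff pairwise_def)
      then show ?thesis unfolding L_def by linarith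
    qed
    moreover have "S = (\<Union>r\<in>{..<N}. {i \<in> S. i mod N = r})" by (auto simp: N_def)
    then have "card S \<le> (\<Sum>r\<in>{..<N}. card {i \<in> S. i mod N = r})"
      by (metis card_UN_le finite_lessThan)
    ultimately have "card S \<le> (\<Sum>r\<in>{..<N}. L)" by (meson order_trans sum_mono)
    then show "card {i \<in> {..<n}. e \<le> cmod (\<sigma> (left_regular (shift_word (int i) g)))} \<le> N * L"
      by (simp add: S_def)
  qed
  then show ?thesis by (rule that)
qed

section \<open>Entropy estimates\<close>

text \<open>Listing the elements and padding with \<open>None\<close> codes each such subset by a
  word of length exactly \<open>k\<close> over an alphabet of \<open>card A + 1\<close>
  symbols.\<close>

lemma card_subsets_of_bounded_card_le:
  assumes "finite A"
  shows "card {B. B \<subseteq> A \<and> card B \<le> k} \<le> (card A + 1) ^ k"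
proof -
  let ?L = "{xs. set xs \<subseteq> insert None (Some ` A) \<and> length xs = k}"
  have "{B. B \<subseteq> A \<and> card B \<le> k} \<subseteq> (\<lambda>xs. {a. Some a \<in> set xs}) ` ?L"
  proof clarify
    fix B assume B: "B \<subseteq> A" "card B \<le> k"
    then obtain bs where bs: "set bs = B" "distinct bs"
      using assms finite_distinct_list finite_subset by metis
    then have "length bs \<le> k" using B(2) by (metis distinct_card)
    then show "B \<in> (\<lambda>xs. {a. Some a \<in> set xs}) ` ?L"
      using bs B(1)
      by (intro image_eqI[of _ _ "map Some bs @ replicate (k - length bs) None"]) auto
  qed
  moreover have fin: "finite ?L" using assms by (intro finite_lists_length_eq) simp
  ultimately have "card {B. B \<subseteq> A \<and> card B \<le> k} \<le> card ((\<lambda>xs. {a. Some a \<in> set xs}) ` ?L)"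
    by (intro card_mono finite_imageI)
  also have "\<dots> \<le> card ?L" by (rule card_image_le[OF fin])
  also have "\<dots> = (card A + 1) ^ k"
    using assms by (subst card_lists_length_eq) (auto simp: card_image)
  finally show ?thesis .
qed

text \<open>Itineraries index the join: a choice of one cover element for each time below
  \<open>n\<close> gives a member, possibly empty.\<close>

lemma iterated_join_mem:
  assumes "\<And>i. i < n \<Longrightarrow> U i \<in> \<U>"
  shows "{x \<in> topspace X. \<forall>i<n. (T ^^ i) x \<in> U i} \<in> iterated_join X T \<U> n"
  using assms
proof (induction n)
  case (Suc n)
  have "{x \<in> topspace X. \<forall>i<Suc n. (T ^^ i) x \<in> U i} =
      {x \<in> topspace X. \<forall>i<n. (T ^^ i) x \<in> U i} \<inter> {x \<in> topspace X. (T ^^ n) x \<in> U n}"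
    by (auto simp: less_Suc_eq)
  moreover have "{x \<in> topspace X. (T ^^ n) x \<in> U n} \<in> cover_preimage X (T ^^ n) \<U>"
    using Suc.prems[of n] by (auto simp: cover_preimage_def)
  moreover have "{x \<in> topspace X. \<forall>i<n. (T ^^ i) x \<in> U i} \<in> iterated_join X T \<U> n"
    using Suc by simp
  ultimately show ?case
    unfolding iterated_join.simps(2) cover_join_def mem_Collect_eq by (intro exI conjI)
qed simp

lemma subcover_number_le:
  "\<V> \<subseteq> \<U> \<Longrightarrow> finite \<V> \<Longrightarrow> \<Union>\<V> = topspace X \<Longrightarrow> subcover_number X \<U> \<le> card \<V>"
  unfolding subcover_number_def by (intro Least_le exI[of _ \<V>] conjI refl)

text \<open>Here \<open>D\<close> describes orbit segments of length \<open>n\<close>, and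
  \<open>R\<close> is a closeness relation finer than the cover. Each description yields one member
  of the join, built along the orbit of a chosen representative; every point with that description
  follows this orbit up to \<open>R\<close>.\<close>

lemma subcover_number_iterated_join_le:
  assumes fin: "finite (D ` topspace X)"
    and T: "\<And>x i. x \<in> topspace X \<Longrightarrow> (T ^^ i) x \<in> topspace X"
    and U: "\<And>x. x \<in> topspace X \<Longrightarrow> \<exists>U\<in>\<U>. {y \<in> topspace X. R x y} \<subseteq> U"
    and D: "\<And>x y i. x \<in> topspace X \<Longrightarrow> y \<in> topspace X \<Longrightarrow> D x = D y \<Longrightarrow> i < n \<Longrightarrow> R ((T ^^ i) x) ((T ^^ i) y)"
  shows "subcover_number X (iterated_join X T \<U> n) \<le> card (D ` topspace X)"
proof -
  from U have "\<forall>x\<in>topspace X. \<exists>U. U \<in> \<U> \<and> {y \<in> topspace X. R x y} \<subseteq> U" by blast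
  from bchoice[OF this] obtain u where
    u: "\<And>x. x \<in> topspace X \<Longrightarrow> u x \<in> \<U> \<and> {y \<in> topspace X. R x y} \<subseteq> u x" by blast
  define r where "r d = (SOME x. x \<in> topspace X \<and> D x = d)" for d
  have r: "r (D x) \<in> topspace X \<and> D (r (D x)) = D x" if "x \<in> topspace X" for x
    unfolding r_def by (rule someI[of _ x]) (use that in simp)
  define W where "W d = {x \<in> topspace X. \<forall>i<n. (T ^^ i) x \<in> u ((T ^^ i) (r d))}" for d
  have "W ` D ` topspace X \<subseteq> iterated_join X T \<U> n"
    using r T u by (auto simp: W_def intro!: iterated_join_mem)
  moreover have "x \<in> W (D x)" if "x \<in> topspace X" for x
  proof -
    have rx: "r (D x) \<in> topspace X" "D (r (D x)) = D x" using r[OF that] by auto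
    have "(T ^^ i) x \<in> u ((T ^^ i) (r (D x)))" if "i < n" for i
      using D[OF rx(1) _ rx(2) that] u[OF T[OF rx(1)]] T \<open>x \<in> topspace X\<close> by blast
    then show ?thesis using that by (simp add: W_def)
  qed
  then have "\<Union>(W ` D ` topspace X) = topspace X" by (auto simp: W_def)
  ultimately have "subcover_number X (iterated_join X T \<U> n) \<le> card (W ` D ` topspace X)"
    using fin by (intro subcover_number_le) auto
  also have "\<dots> \<le> card (D ` topspace X)" by (rule card_image_le[OF fin])
  finally show ?thesis .
qed

text \<open>The logarithm of a polynomial grows slower than \<open>n\<close>. As
  \<open>cover_entropy\<close> is a \<open>lim\<close>, convergence is proved together with the
  value.\<close>

lemma cover_entropy_eq_0_if_polynomial_growth:
  assumes "\<And>n. subcover_number X (iterated_join X T \<U> n) \<le> (C * n + 1) ^ k"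
  shows "cover_entropy X T \<U> = 0"
proof -
  define N where "N n = subcover_number X (iterated_join X T \<U> n)" for n
  \<comment> \<open>With \<open>C + 1\<close> in place of \<open>C\<close> the coefficient of
    \<open>n\<close> is positive, as the limit below requires. The case \<open>N n = 0\<close> is
    covered by the convention \<open>ln 0 = 0\<close>.\<close>
  have bound: "ln (real (N n)) / real n \<le> real k * ln ((real C + 1) * real n + 1) / real n" for n
  proof (cases "N n = 0")
    case False
    then have "ln (real (N n)) \<le> ln (real ((C * n + 1) ^ k))"
      using assms[of n] by (subst ln_le_cancel_iff) (auto simp: N_def simp del: of_nat_power)
    also have "\<dots> = real k * ln (real C * real n + 1)"
      by (simp add: ln_realpow add_nonneg_pos add.commute)
    also have "\<dots> \<le> real k * ln ((real C + 1) * real n + 1)"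
      by (intro mult_left_mono ln_mono) (auto simp: distrib_right add_nonneg_pos)
    finally show ?thesis by (rule divide_right_mono) simp
  qed simp
  have "(\<lambda>n. ln (real (N n)) / real n) \<longlonglongrightarrow> 0"
  proof (rule tendsto_sandwich)
    have "0 \<le> ln (real (N n)) / real n" for n by (cases "N n = 0") auto
    then show "\<forall>\<^sub>F n in sequentially. 0 \<le> ln (real (N n)) / real n"
      by (intro always_eventually allI)
    show "\<forall>\<^sub>F n in sequentially. ln (real (N n)) / real n \<le> real k * ln ((real C + 1) * real n + 1) / real n"
      using bound by (intro always_eventually allI)
    have "(\<lambda>n. a * ln (c * real n + 1) / real n) \<longlonglongrightarrow> 0" if "c > 0" for a c :: real
      using that by real_asymp
    then show "(\<lambda>n. real k * ln ((real C + 1) * real n + 1) / real n) \<longlonglongrightarrow> 0" by simp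
  qed (rule tendsto_const)
  then show ?thesis unfolding cover_entropy_def N_def by (rule limI)
qed

text \<open>The square containing \<open>z\<close> in a grid of side \<open>1 / c\<close>; points of
  one square are less than \<open>2 / c\<close> apart, and a disc meets only finitely many
  squares.\<close>

definition cell :: "real \<Rightarrow> complex \<Rightarrow> int \<times> int" where
  "cell c z = (\<lfloor>c * Re z\<rfloor>, \<lfloor>c * Im z\<rfloor>)"

lemma cell_eq_imp_close:
  assumes c: "c > 0" and eq: "cell c z = cell c w" shows "c * cmod (z - w) < 2"
proof -
  have *: "c * \<bar>x - y\<bar> < 1" if "\<lfloor>c * x\<rfloor> = \<lfloor>c * y\<rfloor>" for x y
  proof -
    have "\<bar>c * x - c * y\<bar> < 1" using that by linarith
    also have "\<bar>c * x - c * y\<bar> = c * \<bar>x - y\<bar>"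
      using c abs_mult[of c "x - y"] by (simp add: right_diff_distrib)
    finally show ?thesis .
  qed
  have "c * cmod (z - w) \<le> c * (\<bar>Re z - Re w\<bar> + \<bar>Im z - Im w\<bar>)"
    using c cmod_le[of "z - w"] by (intro mult_left_mono) auto
  also have "\<dots> < 2"
    using *[of "Re z" "Re w"] *[of "Im z" "Im w"] eq by (simp add: cell_def distrib_left)
  finally show ?thesis .
qed

lemma finite_cells:
  assumes c: "c > 0" shows "finite (cell c ` cball 0 r)"
proof (rule finite_subset)
  let ?I = "{\<lfloor>c * - r\<rfloor>..\<lfloor>c * r\<rfloor>}"
  show "cell c ` cball 0 r \<subseteq> ?I \<times> ?I"
  proof (rule image_subsetI)
    fix z :: complex assume "z \<in> cball 0 r"
    then have "- r \<le> Re z" "Re z \<le> r" "- r \<le> Im z" "Im z \<le> r"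
      using abs_Re_le_cmod[of z] abs_Im_le_cmod[of z] by auto
    then show "cell c z \<in> ?I \<times> ?I"
      unfolding cell_def mem_Times_iff fst_conv snd_conv atLeastAtMost_iff
      using c by (intro conjI floor_mono mult_left_mono) simp_all
  qed
qed simp

section \<open>The shift\<close>

text \<open>Peeling off the first letter of a reduced word leaves a reduced word. The rule extends
  formulas for multiplicative maps from generators and their inverses to the whole group.\<close>

lemma free_group_induct [case_names zero generator inverse]:
  assumes "P 0" "\<And>i h. P h \<Longrightarrow> P (generator i + h)" "\<And>i h. P h \<Longrightarrow> P (- generator i + h)"
  shows "P g"
proof -
  have "\<forall>g. word_of g = w \<longrightarrow> P g" for w
  proof (induction w)
    case Nil
    then show ?case using assms(1) by (metis word_of_inject zero_free_group.rep_eq)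
  next
    case (Cons x w)
    show ?case
    proof (intro allI impI)
      fix g assume g: "word_of g = x # w"
      have red: "reduced_word (x # w)" using word_of[of g] g by simp
      then have w: "word_of (of_word w) = w" by (simp add: of_word_inverse reduced_Cons)
      \<comment> \<open>The element with the one-letter word \<open>[x]\<close>; adding it on the
        left cancels nothing, because \<open>x # w\<close> is reduced.\<close>
      define l where "l = (if snd x then generator (fst x) else - generator (fst x))"
      have "word_of l = [x]"
        by (cases x) (auto simp: l_def generator.rep_eq uminus_free_group.rep_eq flip_def)
      then have "word_of (l + of_word w) = word_of g"
        using lmul_reduced[OF red] by (simp add: plus_free_group.rep_eq w g)
      then have "g = l + of_word w" by (simp add: word_of_inject)
      moreover have "P (of_word w)" using Cons w by blast
      ultimately show "P g" using assms(2,3) by (auto simp: l_def)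
    qed
  qed
  then show ?thesis by blast
qed

text \<open>Surjectivity gives the unit: if \<open>\<alpha> b = 1\<close>, then
  \<open>1 = \<alpha> (b 1) = \<alpha> b \<alpha> 1 = \<alpha> 1\<close>.\<close>

lemma star_automorphism_id:
  assumes "star_automorphism reduced_cstar \<alpha>" shows "\<alpha> id_blinfun = id_blinfun"
proof -
  obtain b where b: "b \<in> reduced_cstar" "\<alpha> b = id_blinfun"
    using assms id_in_reduced_cstar unfolding star_automorphism_def bij_betw_def by (metis imageE)
  have "id_blinfun = \<alpha> (b o\<^sub>L id_blinfun)"
    using b(2) by (simp add: blinfun_eqI[of "b o\<^sub>L id_blinfun" b])
  also have "\<dots> = \<alpha> b o\<^sub>L \<alpha> id_blinfun"
    using assms b(1) id_in_reduced_cstar unfolding star_automorphism_def by blast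
  also have "\<dots> = \<alpha> id_blinfun" unfolding b(2) by (rule blinfun_eqI) simp
  finally show ?thesis by simp
qed

text \<open>Both sides are multiplicative in \<open>g\<close>, so generators and their inverses
  suffice. The unitary of an inverse is an adjoint, and \<open>\<alpha>\<close> preserves
  adjoints.\<close>

lemma shift_automorphism_left_regular:
  assumes \<alpha>: "star_automorphism reduced_cstar \<alpha>"
    and gen: "\<And>i. \<alpha> (left_regular (generator i)) = left_regular (generator (i + 1))"
  shows "\<alpha> (left_regular g) = left_regular (shift_word 1 g)"
proof -
  have hom: "\<alpha> (left_regular (g + h)) = \<alpha> (left_regular g) o\<^sub>L \<alpha> (left_regular h)" for g h
    using \<alpha> unfolding star_automorphism_def left_regular_add
    by (blast intro: left_regular_in_reduced_cstar)
  have adj: "cadjoint (left_regular g) = left_regular (- g)" for g :: "int free_group"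
    by (intro cadjoint_eqI is_cadjoint_left_regular)
  have inv: "\<alpha> (left_regular (- generator i)) = left_regular (- generator (i + 1))" for i
    using \<alpha> unfolding star_automorphism_def adj[symmetric] gen[symmetric]
    by (blast intro: left_regular_in_reduced_cstar)
  have shift_0: "shift_word 1 0 = 0" by transfer simp
  have shift_inv: "shift_word 1 (- generator i) = - generator (i + 1)" for i
    by transfer (simp add: flip_def)
  show ?thesis
    by (induction g rule: free_group_induct)
      (simp_all only: hom gen inv shift_word_add shift_word_generator shift_inv shift_0
        left_regular_0 star_automorphism_id[OF \<alpha>], simp_all only: left_regular_add)
qed

text \<open>Positivity survives because \<open>\<alpha>\<close> sends the product of the adjoint of
  \<open>a\<close> with \<open>a\<close> to the same product for \<open>\<alpha> a\<close>; the unit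
  is fixed.\<close>

lemma state_map_in_state_space:
  assumes \<alpha>: "star_automorphism reduced_cstar \<alpha>" and \<sigma>: "\<sigma> \<in> state_space reduced_cstar"
  shows "state_map reduced_cstar \<alpha> \<sigma> \<in> state_space reduced_cstar"
proof -
  have \<alpha>A: "\<alpha> a \<in> reduced_cstar" if "a \<in> reduced_cstar" for a
    using \<alpha> that unfolding star_automorphism_def bij_betw_def by blast
  have "state_map reduced_cstar \<alpha> \<sigma> (cadjoint a o\<^sub>L a) \<in> \<real>\<^sub>\<ge>\<^sub>0" if a: "a \<in> reduced_cstar" for a
  proof -
    obtain b where b: "b \<in> reduced_cstar" "is_cadjoint a b" by (rule reduced_cstar_cadjoint[OF a])
    have ba: "cadjoint a = b" by (rule cadjoint_eqI[OF b(2)])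
    have "\<alpha> (b o\<^sub>L a) = cadjoint (\<alpha> a) o\<^sub>L \<alpha> a"
      using \<alpha> a b(1) unfolding star_automorphism_def ba[symmetric] by metis
    then show ?thesis
      using \<sigma> \<alpha>A[OF a] reduced_cstar_compose[OF b(1) a]
      by (simp add: state_map_def state_space_def ba)
  qed
  then show ?thesis
    using \<sigma> \<alpha> \<alpha>A star_automorphism_id[OF \<alpha>]
    by (simp add: state_space_def state_map_def star_automorphism_def reduced_cstar_add
        reduced_cstar_scaleC id_in_reduced_cstar)
qed

text \<open>The values along an orbit become values of one state at translates of a word, to which
  \<open>card_large_state_values\<close> applies. The induction varies \<open>g\<close> because each
  step moves one shift into the argument.\<close>

lemma state_map_funpow_left_regular:
  assumes \<alpha>: "star_automorphism reduced_cstar \<alpha>"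
    and gen: "\<And>i. \<alpha> (left_regular (generator i)) = left_regular (generator (i + 1))"
  shows "(state_map reduced_cstar \<alpha> ^^ n) \<sigma> (left_regular g)
    = \<sigma> (left_regular (shift_word (int n) g))"
proof (induction n arbitrary: g)
  case (Suc n)
  have "(state_map reduced_cstar \<alpha> ^^ Suc n) \<sigma> (left_regular g)
      = (state_map reduced_cstar \<alpha> ^^ n) \<sigma> (\<alpha> (left_regular g))"
    by (simp add: state_map_def left_regular_in_reduced_cstar)
  then show ?case
    by (simp add: shift_automorphism_left_regular[OF \<alpha> gen] Suc shift_word_shift_word add.commute)
qed (simp add: shift_word_0)

lemma cover_entropy_shift_eq_0:
  fixes \<alpha> :: "int free_group op \<Rightarrow> int free_group op"
  assumes \<alpha>: "star_automorphism reduced_cstar \<alpha>"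
    and gen: "\<And>i. \<alpha> (left_regular (generator i)) = left_regular (generator (i + 1))"
    and \<U>: "finite_open_cover (state_topology reduced_cstar) \<U>"
  shows "cover_entropy (state_topology reduced_cstar) (state_map reduced_cstar \<alpha>) \<U> = 0"
proof -
  let ?S = "state_space (reduced_cstar :: int free_group op set)"
  let ?T = "state_map reduced_cstar \<alpha>"
  obtain G \<delta> where G: "finite G" and \<delta>: "\<delta> > 0"
    and leb: "\<And>\<sigma>. \<sigma> \<in> ?S \<Longrightarrow> \<exists>U\<in>\<U>. group_ball G \<delta> \<sigma> \<subseteq> U"
    by (rule lebesgue_number_states[OF \<U>]) blast
  \<comment> \<open>The identity is set aside: every state takes the value 1 there, and the count of
    large values requires \<open>g \<noteq> 0\<close>.\<close>
  define H where "H = G - {0}"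
  have "\<forall>g\<in>H. \<exists>K. \<forall>\<sigma>\<in>?S. \<forall>n.
      card {i \<in> {..<n}. \<delta> / 2 \<le> cmod (\<sigma> (left_regular (shift_word (int i) g)))} \<le> K"
  proof
    fix g assume "g \<in> H"
    then obtain K where "\<And>\<sigma> n. \<sigma> \<in> ?S \<Longrightarrow>
        card {i \<in> {..<n}. \<delta> / 2 \<le> cmod (\<sigma> (left_regular (shift_word (int i) g)))} \<le> K"
      using card_large_state_values[of g "\<delta> / 2"] \<delta> by (auto simp: H_def)
    then show "\<exists>K. \<forall>\<sigma>\<in>?S. \<forall>n.
      card {i \<in> {..<n}. \<delta> / 2 \<le> cmod (\<sigma> (left_regular (shift_word (int i) g)))} \<le> K" by blast
  qed
  from bchoice[OF this] obtain K where K: "\<And>g \<sigma> n. g \<in> H \<Longrightarrow> \<sigma> \<in> ?S \<Longrightarrow>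
      card {i \<in> {..<n}. \<delta> / 2 \<le> cmod (\<sigma> (left_regular (shift_word (int i) g)))} \<le> K g" by blast
  \<comment> \<open>All cells that values of states on the group can have, by the bound 2 in
    \<open>state_left_regular_bound\<close>. At scale \<open>2 / \<delta>\<close>, values in one
    cell differ by less than \<open>\<delta>\<close>.\<close>
  define Q where "Q = cell (2 / \<delta>) ` cball 0 2"
  have Q: "finite Q" unfolding Q_def by (rule finite_cells) (simp add: \<delta>)
  define k where "k = (\<Sum>g\<in>H. K g)"
  define C where "C = card H * card Q"
  \<comment> \<open>Two values below the threshold \<open>\<delta> / 2\<close> differ by less than
    \<open>\<delta>\<close>, so small values need no record.\<close>
  define E where "E n \<sigma> = (SIGMA g:H. {i \<in> {..<n}. \<delta> / 2 \<le> cmod (\<sigma> (left_regular (shift_word (int i) g)))})"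
    for n and \<sigma> :: "int free_group op \<Rightarrow> complex"
  \<comment> \<open>The description of a state: the graph of its rounded values over the large
    positions. Its cardinality is at most \<open>k\<close>, which does not depend on
    \<open>n\<close>.\<close>
  define D where "D n \<sigma> = (\<lambda>(g, i). ((g, i), cell (2 / \<delta>) (\<sigma> (left_regular (shift_word (int i) g))))) ` E n \<sigma>"
    for n and \<sigma> :: "int free_group op \<Rightarrow> complex"
  have H: "finite H" using G by (simp add: H_def)
  have "subcover_number (state_topology reduced_cstar) (iterated_join (state_topology reduced_cstar) ?T \<U> n)
      \<le> (C * n + 1) ^ k" for n
  proof -
    let ?A = "(H \<times> {..<n}) \<times> Q"
    have E: "finite (E n \<sigma>)" for \<sigma> using H by (simp add: E_def)
    have "D n \<sigma> \<subseteq> ?A" if "\<sigma> \<in> ?S" for \<sigma>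
      using state_left_regular_bound[OF that] by (auto simp: D_def E_def Q_def)
    moreover have "card (D n \<sigma>) \<le> k" if "\<sigma> \<in> ?S" for \<sigma>
    proof -
      have "card (D n \<sigma>) \<le> card (E n \<sigma>)" unfolding D_def by (rule card_image_le[OF E])
      also have "\<dots> \<le> k"
        unfolding E_def k_def using H K that by (subst card_SigmaI) (auto intro: sum_mono)
      finally show ?thesis .
    qed
    ultimately have sub: "D n ` ?S \<subseteq> {B. B \<subseteq> ?A \<and> card B \<le> k}" by blast
    have A: "finite ?A" using H Q by simp
    then have fin: "finite {B. B \<subseteq> ?A \<and> card B \<le> k}" by simp
    have T: "(?T ^^ i) \<sigma> \<in> ?S" if "\<sigma> \<in> ?S" for \<sigma> i
      using that by (induction i) (auto intro: state_map_in_state_space[OF \<alpha>])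
    have "subcover_number (state_topology reduced_cstar) (iterated_join (state_topology reduced_cstar) ?T \<U> n)
      \<le> card (D n ` topspace (state_topology reduced_cstar))"
    proof (rule subcover_number_iterated_join_le[where R = "\<lambda>\<sigma> \<tau>. \<tau> \<in> group_ball G \<delta> \<sigma>"], unfold topspace_state_topology)
      show "finite (D n ` ?S)" by (rule finite_subset[OF sub fin])
      show "\<exists>U\<in>\<U>. {\<tau> \<in> ?S. \<tau> \<in> group_ball G \<delta> \<sigma>} \<subseteq> U" if "\<sigma> \<in> ?S" for \<sigma>
        using leb[OF that] by blast
      fix \<sigma> \<tau> i
      assume \<sigma>: "\<sigma> \<in> ?S" and \<tau>: "\<tau> \<in> ?S" and eq: "D n \<sigma> = D n \<tau>" and i: "i < n"
      have "cmod (\<tau> (left_regular (shift_word (int i) g)) - \<sigma> (left_regular (shift_word (int i) g))) < \<delta>"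
        if g: "g \<in> G" for g
      proof (cases "g = 0")
        case True
        then have "shift_word (int i) g = 0" by (simp add: shift_word_eq_0_iff)
        then show ?thesis using \<delta> by (simp add: left_regular_0 state_id[OF \<sigma>] state_id[OF \<tau>])
      next
        case False
        define z where "z \<rho> = \<rho> (left_regular (shift_word (int i) g))"
          for \<rho> :: "int free_group op \<Rightarrow> complex"
        \<comment> \<open>Membership records both whether a value is large and its cell. For states
          with equal descriptions, a value large for one is large for the other and has the same
          cell.\<close>
        have mem: "((g, i), q) \<in> D n \<rho> \<longleftrightarrow> \<delta> / 2 \<le> cmod (z \<rho>) \<and> q = cell (2 / \<delta>) (z \<rho>)" for \<rho> q
          using g i False by (auto simp: D_def E_def H_def z_def)
        have "cmod (z \<tau> - z \<sigma>) < \<delta>"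
        proof (cases "\<delta> / 2 \<le> cmod (z \<sigma>) \<or> \<delta> / 2 \<le> cmod (z \<tau>)")
          case True
          then have "cell (2 / \<delta>) (z \<tau>) = cell (2 / \<delta>) (z \<sigma>)"
            using mem[of _ \<sigma>] mem[of _ \<tau>] eq by metis
          then have "2 / \<delta> * cmod (z \<tau> - z \<sigma>) < 2"
            using \<delta> by (intro cell_eq_imp_close) simp_all
          then show ?thesis using \<delta> by (simp add: divide_less_eq)
        next
          case False
          then show ?thesis using norm_triangle_ineq4[of "z \<tau>" "z \<sigma>"] by linarith
        qed
        then show ?thesis by (simp add: z_def)
      qed
      then show "(?T ^^ i) \<tau> \<in> group_ball G \<delta> ((?T ^^ i) \<sigma>)"
        using T[OF \<tau>] by (simp add: group_ball_def state_map_funpow_left_regular[OF \<alpha> gen])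
    qed (rule T)
    also have "\<dots> \<le> card {B. B \<subseteq> ?A \<and> card B \<le> k}"
      unfolding topspace_state_topology by (rule card_mono[OF fin sub])
    also have "\<dots> \<le> (card ?A + 1) ^ k" by (rule card_subsets_of_bounded_card_le[OF A])
    also have "card ?A = C * n" by (simp add: C_def card_cartesian_product)
    finally show ?thesis .
  qed
  then show ?thesis by (rule cover_entropy_eq_0_if_polynomial_growth)
qed

theorem proposition3p7:
  fixes \<alpha> :: "int free_group op \<Rightarrow> int free_group op"
  assumes "star_automorphism reduced_cstar \<alpha>"
    and "\<And>i. \<alpha> (left_regular (generator i)) = left_regular (generator (i + 1))"
  shows "topological_entropy (state_topology reduced_cstar) (state_map reduced_cstar \<alpha>) = 0"
proof -
  let ?X = "state_topology (reduced_cstar :: int free_group op set)"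
  let ?\<C> = "{\<U>. finite_open_cover ?X \<U>}"
  \<comment> \<open>The trivial cover makes the family nonempty; the supremum over an empty family
    would be \<open>-\<infinity>\<close> instead of 0.\<close>
  have "{topspace ?X} \<in> ?\<C>" by (simp add: finite_open_cover_def)
  then have "?\<C> \<noteq> {}" by blast
  moreover have "(SUP \<U>\<in>?\<C>. ereal (cover_entropy ?X (state_map reduced_cstar \<alpha>) \<U>)) = (SUP \<U>\<in>?\<C>. 0)"
    using cover_entropy_shift_eq_0[OF assms] by (intro SUP_cong) simp_all
  ultimately show ?thesis by (simp add: topological_entropy_def)
qed

end
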